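(* Each one of the three categories $\mathsf{ALat}$, $\mathsf{ADom}$ and $\mathsf{Spec}$ is closed under weighted limits in $\mathsf{Top}_0$.
   Context: $\mathsf{Top}_0$ is the category of $T_0$ spaces and continuous maps, order-enriched by the pointwise specialisation order ($x\le y$ iff every open set containing $x$ contains $y$). An element $c$ of a poset with directed suprema is compact if $c\le\bigvee D$, $D$ directed, implies $c\le d$ for some $d\in D$. An algebraic domain is a poset with directed suprema in which every element is the directed supremum of the compact elements below it; an algebraic lattice is an algebraic domain which is a complete lattice. A poset is bounded complete if every subset with an upper bound has a least one (for domains, equivalently: all non-empty infima exist). $\mathsf{ALat}$: algebraic lattices with maps preserving directed suprema and all infima. $\mathsf{ADom}$: bounded complete algebraic domains with maps preserving directed suprema and all non-empty infima. In both cases objects are viewed as topological spaces with the Scott topology, making these categories (non-full) subcategories of $\mathsf{Top}_0$. A stably compact space is a sober, locally compact space in which finite intersections of compact saturated sets are compact (saturated = upper set in the specialisation order); a continuous map between such spaces is spectral if preimages of compact saturated sets are compact. A spectral space is a stably compact space whose compact open sets form a base. $\mathsf{Spec}$: spectral spaces and spectral maps. Weighted limits: for a small order-enriched category $\mathsf{D}$ and order-enriched functors (monotone on hom-posets) $D:\mathsf{D}\to\mathsf{B}$, $W:\mathsf{D}\to\mathsf{Pos}$, a limit of $D$ weighted by $W$ is an object $L$ with morphisms $l_d^x:L\to Dd$ ($d\in\mathsf{D}$, $x\in Wd$) such that (a) $l_d^x\le l_d^y$ if $x\le y$, and $Dn\cdot l_d^x=l_{d'}^{Wn(x)}$ for $n:d\to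 d'$; (b) every family $a_d^x:A\to Dd$ satisfying the analogue of (a) is $a_d^x=l_d^x t$ for a unique $t:A\to L$, and $l_d^xt\le l_d^xt'$ for all $d,x$ implies $t\le t'$. $\mathsf{Top}_0$ has weighted limits. A subcategory $\mathsf{A}$ of $\mathsf{Top}_0$ is closed under weighted limits in $\mathsf{Top}_0$ if every weighted limit in $\mathsf{Top}_0$ of a diagram in $\mathsf{A}$ lies, with its projections, in $\mathsf{A}$ and is a weighted limit in $\mathsf{A}$. *)

theory Defs
  imports "HOL-Algebra.Complete_Lattice" "HOL-Analysis.Analysis"
begin

section \<open>Domains\<close>

definition directed_in :: "('a, 'e) gorder_scheme \<Rightarrow> 'a set \<Rightarrow> bool" where
  "directed_in P D \<longleftrightarrow> D \<subseteq> carrier P \<and> D \<noteq> {} \<and>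
     (\<forall>x\<in>D. \<forall>y\<in>D. \<exists>z\<in>D. x \<sqsubseteq>\<^bsub>P\<^esub> z \<and> y \<sqsubseteq>\<^bsub>P\<^esub> z)"

definition dcpo :: "('a, 'e) gorder_scheme \<Rightarrow> bool" where
  "dcpo P \<longleftrightarrow> partial_order P \<and> (\<forall>D. directed_in P D \<longrightarrow> (\<exists>s. is_lub P s D))"

definition compact_element :: "('a, 'e) gorder_scheme \<Rightarrow> 'a \<Rightarrow> bool" where
  "compact_element P c \<longleftrightarrow> c \<in> carrier P \<and>
     (\<forall>D s. directed_in P D \<longrightarrow> is_lub P s D \<longrightarrow> c \<sqsubseteq>\<^bsub>P\<^esub> s \<longrightarrow> (\<exists>d\<in>D. c \<sqsubseteq>\<^bsub>P\<^esub> d))"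

definition algebraic_domain :: "('a, 'e) gorder_scheme \<Rightarrow> bool" where
  "algebraic_domain P \<longleftrightarrow> dcpo P \<and>
     (\<forall>x\<in>carrier P. directed_in P {c. compact_element P c \<and> c \<sqsubseteq>\<^bsub>P\<^esub> x} \<and>
                    is_lub P x {c. compact_element P c \<and> c \<sqsubseteq>\<^bsub>P\<^esub> x})"

definition algebraic_lattice :: "('a, 'e) gorder_scheme \<Rightarrow> bool" where
  "algebraic_lattice P \<longleftrightarrow> algebraic_domain P \<and> complete_lattice P"

definition bounded_complete :: "('a, 'e) gorder_scheme \<Rightarrow> bool" where
  "bounded_complete P \<longleftrightarrow> (\<forall>S\<subseteq>carrier P. Upper P S \<noteq> {} \<longrightarrow> (\<exists>s. is_lub P s S))"

definition preserves_directed_sups ::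
    "('a, 'e) gorder_scheme \<Rightarrow> ('b, 'f) gorder_scheme \<Rightarrow> ('a \<Rightarrow> 'b) \<Rightarrow> bool" where
  "preserves_directed_sups P Q f \<longleftrightarrow> f \<in> carrier P \<rightarrow> carrier Q \<and>
     (\<forall>D s. directed_in P D \<longrightarrow> is_lub P s D \<longrightarrow> is_lub Q (f s) (f ` D))"

definition preserves_infs ::
    "('a, 'e) gorder_scheme \<Rightarrow> ('b, 'f) gorder_scheme \<Rightarrow> ('a \<Rightarrow> 'b) \<Rightarrow> bool" where
  "preserves_infs P Q f \<longleftrightarrow> f \<in> carrier P \<rightarrow> carrier Q \<and>
     (\<forall>S i. S \<subseteq> carrier P \<longrightarrow> is_glb P i S \<longrightarrow> is_glb Q (f i) (f ` S))"

definition preserves_nonempty_infs ::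
    "('a, 'e) gorder_scheme \<Rightarrow> ('b, 'f) gorder_scheme \<Rightarrow> ('a \<Rightarrow> 'b) \<Rightarrow> bool" where
  "preserves_nonempty_infs P Q f \<longleftrightarrow> f \<in> carrier P \<rightarrow> carrier Q \<and>
     (\<forall>S i. S \<subseteq> carrier P \<longrightarrow> S \<noteq> {} \<longrightarrow> is_glb P i S \<longrightarrow> is_glb Q (f i) (f ` S))"

definition scott_open :: "('a, 'e) gorder_scheme \<Rightarrow> 'a set \<Rightarrow> bool" where
  "scott_open P U \<longleftrightarrow> U \<subseteq> carrier P \<and>
     (\<forall>x\<in>U. \<forall>y\<in>carrier P. x \<sqsubseteq>\<^bsub>P\<^esub> y \<longrightarrow> y \<in> U) \<and>
     (\<forall>D s. directed_in P D \<longrightarrow> is_lub P s D \<longrightarrow> s \<in> U \<longrightarrow> D \<inter> U \<noteq> {})"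

definition scott_topology :: "('a, 'e) gorder_scheme \<Rightarrow> 'a topology" where
  "scott_topology P = topology (scott_open P)"

lemma istopology_scott_open: "istopology (scott_open P)"
proof -
  have "scott_open P (S \<inter> T)" if S: "scott_open P S" and T: "scott_open P T" for S T
    unfolding scott_open_def
  proof (intro conjI allI impI)
    show "S \<inter> T \<subseteq> carrier P" using S by (auto simp: scott_open_def)
    show "\<forall>x\<in>S \<inter> T. \<forall>y\<in>carrier P. x \<sqsubseteq>\<^bsub>P\<^esub> y \<longrightarrow> y \<in> S \<inter> T"
      using S T unfolding scott_open_def by blast
    fix D s assume D: "directed_in P D" and s: "is_lub P s D" "s \<in> S \<inter> T"
    from S D s obtain x where x: "x \<in> D" "x \<in> S" unfolding scott_open_def by blast
    from T D s obtain y where y: "y \<in> D" "y \<in> T" unfolding scott_open_def by blast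
    from D x y obtain z where z: "z \<in> D" "x \<sqsubseteq>\<^bsub>P\<^esub> z" "y \<sqsubseteq>\<^bsub>P\<^esub> z"
      unfolding directed_in_def by blast
    with D have "z \<in> carrier P" unfolding directed_in_def by blast
    with x y z S T have "z \<in> S" "z \<in> T" by (simp_all add: scott_open_def)
    with z show "D \<inter> (S \<inter> T) \<noteq> {}" by blast
  qed
  moreover have "scott_open P (\<Union>\<K>)" if K: "\<forall>K\<in>\<K>. scott_open P K" for \<K>
    unfolding scott_open_def
  proof (intro conjI allI impI)
    show "\<Union>\<K> \<subseteq> carrier P" using K unfolding scott_open_def by blast
    show "\<forall>x\<in>\<Union>\<K>. \<forall>y\<in>carrier P. x \<sqsubseteq>\<^bsub>P\<^esub> y \<longrightarrow> y \<in> \<Union>\<K>"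
      using K unfolding scott_open_def by (metis UnionE UnionI)
    fix D s assume D: "directed_in P D" "is_lub P s D" "s \<in> \<Union>\<K>"
    then obtain K where "K \<in> \<K>" "s \<in> K" by blast
    with K D have "D \<inter> K \<noteq> {}" unfolding scott_open_def by metis
    with \<open>K \<in> \<K>\<close> show "D \<inter> \<Union>\<K> \<noteq> {}" by blast
  qed
  ultimately show ?thesis by (simp add: istopology_def)
qed

lemma openin_scott_topology [simp]: "openin (scott_topology P) U \<longleftrightarrow> scott_open P U"
  by (simp add: scott_topology_def istopology_scott_open)

lemma topspace_scott_topology [simp]: "topspace (scott_topology P) = carrier P"
proof -
  have "scott_open P (carrier P)"
    unfolding scott_open_def directed_in_def by (simp add: Int_absorb2)
  moreover have "U \<subseteq> carrier P" if "scott_open P U" for U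
    using that by (simp add: scott_open_def)
  ultimately show ?thesis
    unfolding topspace_def openin_scott_topology by blast
qed


section \<open>Specialisation order and stably compact spaces\<close>

definition specialisation :: "'a topology \<Rightarrow> 'a gorder" where
  "specialisation X = \<lparr>carrier = topspace X, eq = (=),
     le = (\<lambda>x y. \<forall>U. openin X U \<longrightarrow> x \<in> U \<longrightarrow> y \<in> U)\<rparr>"

text \<open>The Scott topology determines the order, so a poset and its Scott space can be
  identified; the spaces arising from posets in this way are those with
  \<open>X = scott_topology (specialisation X)\<close>.\<close>

lemma specialisation_scott_topology:
  assumes "partial_order P" "x \<in> carrier P" "y \<in> carrier P"
  shows "x \<sqsubseteq>\<^bsub>specialisation (scott_topology P)\<^esub> y \<longleftrightarrow> x \<sqsubseteq>\<^bsub>P\<^esub> y"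
proof
  interpret partial_order P by fact
  show "x \<sqsubseteq>\<^bsub>P\<^esub> y \<Longrightarrow> x \<sqsubseteq>\<^bsub>specialisation (scott_topology P)\<^esub> y"
    using assms by (auto simp: specialisation_def scott_open_def)
  assume le: "x \<sqsubseteq>\<^bsub>specialisation (scott_topology P)\<^esub> y"
  let ?U = "{z \<in> carrier P. \<not> z \<sqsubseteq>\<^bsub>P\<^esub> y}"
  have "scott_open P ?U"
    unfolding scott_open_def
  proof (intro conjI allI impI)
    show "?U \<subseteq> carrier P" by blast
    show "\<forall>x\<in>?U. \<forall>z\<in>carrier P. x \<sqsubseteq>\<^bsub>P\<^esub> z \<longrightarrow> z \<in> ?U"
      using assms(3) by (blast intro: le_trans)
    fix D s assume D: "directed_in P D" and s: "is_lub P s D" "s \<in> ?U"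
    show "D \<inter> ?U \<noteq> {}"
    proof
      assume "D \<inter> ?U = {}"
      with D assms have "y \<in> Upper P D" by (auto simp: Upper_def directed_in_def)
      with s show False by (auto simp: least_def)
    qed
  qed
  with le assms show "x \<sqsubseteq>\<^bsub>P\<^esub> y" by (auto simp: specialisation_def)
qed

definition saturated_in :: "'a topology \<Rightarrow> 'a set \<Rightarrow> bool" where
  "saturated_in X S \<longleftrightarrow> S \<subseteq> topspace X \<and>
     (\<forall>x\<in>S. \<forall>y\<in>topspace X. x \<sqsubseteq>\<^bsub>specialisation X\<^esub> y \<longrightarrow> y \<in> S)"

definition irreducible_closed_in :: "'a topology \<Rightarrow> 'a set \<Rightarrow> bool" where
  "irreducible_closed_in X C \<longleftrightarrow> closedin X C \<and> C \<noteq> {} \<and>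
     (\<forall>A B. closedin X A \<longrightarrow> closedin X B \<longrightarrow> C = A \<union> B \<longrightarrow> C = A \<or> C = B)"

definition sober_space :: "'a topology \<Rightarrow> bool" where
  "sober_space X \<longleftrightarrow>
     (\<forall>C. irreducible_closed_in X C \<longrightarrow> (\<exists>!x. x \<in> topspace X \<and> Abstract_Topology.closure_of X {x} = C))"

text \<open>Without the Hausdorff axiom local compactness must be read as having a base of compact
  neighbourhoods; \<^const>\<open>locally_compact_space\<close> only asks for one compact neighbourhood per
  point. The empty intersection is included among the finite ones, so that a stably compact
  space is compact.\<close>

definition stably_compact_space :: "'a topology \<Rightarrow> bool" where
  "stably_compact_space X \<longleftrightarrow> sober_space X \<and> neighbourhood_base_of (compactin X) X \<and>
     (\<forall>\<K>. finite \<K> \<longrightarrow> (\<forall>K\<in>\<K>. compactin X K \<and> saturated_in X K) \<longrightarrow>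
           compactin X (topspace X \<inter> \<Inter>\<K>))"

definition spectral_space :: "'a topology \<Rightarrow> bool" where
  "spectral_space X \<longleftrightarrow> stably_compact_space X \<and>
     arbitrary union_of (\<lambda>U. openin X U \<and> compactin X U) = openin X"

definition spectral_map :: "'a topology \<Rightarrow> 'b topology \<Rightarrow> ('a \<Rightarrow> 'b) \<Rightarrow> bool" where
  "spectral_map X Y f \<longleftrightarrow> continuous_map X Y f \<and>
     (\<forall>K. compactin Y K \<longrightarrow> saturated_in Y K \<longrightarrow> compactin X {x \<in> topspace X. f x \<in> K})"


section \<open>The categories\<close>

text \<open>The categories are named by tags, rather than passed around as predicates, so that one
  category can contain spaces over different types of points.\<close>

datatype space_cat = Top0 | ALat | ADom | Spec

primrec in_cat :: "space_cat \<Rightarrow> 'a topology \<Rightarrow> bool" where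
  "in_cat Top0 X \<longleftrightarrow> t0_space X"
| "in_cat ALat X \<longleftrightarrow>
     algebraic_lattice (specialisation X) \<and> X = scott_topology (specialisation X)"
| "in_cat ADom X \<longleftrightarrow>
     algebraic_domain (specialisation X) \<and> bounded_complete (specialisation X) \<and>
     X = scott_topology (specialisation X)"
| "in_cat Spec X \<longleftrightarrow> spectral_space X"

text \<open>Morphisms are represented by functions whose values outside the domain are irrelevant;
  accordingly, equality of morphisms is agreement on the domain.\<close>

primrec is_arrow :: "space_cat \<Rightarrow> 'a topology \<Rightarrow> 'b topology \<Rightarrow> ('a \<Rightarrow> 'b) \<Rightarrow> bool" where
  "is_arrow Top0 X Y f \<longleftrightarrow> continuous_map X Y f"
| "is_arrow ALat X Y f \<longleftrightarrow>
     preserves_directed_sups (specialisation X) (specialisation Y) f \<and>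
     preserves_infs (specialisation X) (specialisation Y) f"
| "is_arrow ADom X Y f \<longleftrightarrow>
     preserves_directed_sups (specialisation X) (specialisation Y) f \<and>
     preserves_nonempty_infs (specialisation X) (specialisation Y) f"
| "is_arrow Spec X Y f \<longleftrightarrow> spectral_map X Y f"

definition arrow_eq :: "'a topology \<Rightarrow> ('a \<Rightarrow> 'b) \<Rightarrow> ('a \<Rightarrow> 'b) \<Rightarrow> bool" where
  "arrow_eq X f g \<longleftrightarrow> (\<forall>p\<in>topspace X. f p = g p)"

definition arrow_le :: "'a topology \<Rightarrow> 'b topology \<Rightarrow> ('a \<Rightarrow> 'b) \<Rightarrow> ('a \<Rightarrow> 'b) \<Rightarrow> bool" where
  "arrow_le X Y f g \<longleftrightarrow> (\<forall>p\<in>topspace X. f p \<sqsubseteq>\<^bsub>specialisation Y\<^esub> g p)"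


section \<open>Weighted limits\<close>

record ('o, 'm) ocat =
  objs :: "'o set"
  arrs :: "'m set"
  src :: "'m \<Rightarrow> 'o"
  tgt :: "'m \<Rightarrow> 'o"
  ident :: "'o \<Rightarrow> 'm"
  cmp :: "'m \<Rightarrow> 'm \<Rightarrow> 'm"  \<comment> \<open>\<open>cmp D g f\<close> is \<open>g\<close> after \<open>f\<close>\<close>
  arr_le :: "'m \<Rightarrow> 'm \<Rightarrow> bool"

definition homset :: "('o, 'm) ocat \<Rightarrow> 'o \<Rightarrow> 'o \<Rightarrow> 'm set" where
  "homset D a b = {f \<in> arrs D. src D f = a \<and> tgt D f = b}"

locale order_enriched_category =
  fixes D :: "('o, 'm) ocat"
  assumes src_obj: "f \<in> arrs D \<Longrightarrow> src D f \<in> objs D"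
    and tgt_obj: "f \<in> arrs D \<Longrightarrow> tgt D f \<in> objs D"
    and ident_hom: "a \<in> objs D \<Longrightarrow> ident D a \<in> homset D a a"
    and cmp_hom: "f \<in> homset D a b \<Longrightarrow> g \<in> homset D b c \<Longrightarrow> cmp D g f \<in> homset D a c"
    and cmp_ident_right: "f \<in> homset D a b \<Longrightarrow> cmp D f (ident D a) = f"
    and cmp_ident_left: "f \<in> homset D a b \<Longrightarrow> cmp D (ident D b) f = f"
    and cmp_assoc: "f \<in> homset D a b \<Longrightarrow> g \<in> homset D b c \<Longrightarrow> h \<in> homset D c d \<Longrightarrow>
      cmp D h (cmp D g f) = cmp D (cmp D h g) f"
    and hom_poset: "a \<in> objs D \<Longrightarrow> b \<in> objs D \<Longrightarrow>
      partial_order \<lparr>carrier = homset D a b, eq = (=), le = arr_le D\<rparr>"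
    and cmp_mono: "f \<in> homset D a b \<Longrightarrow> f' \<in> homset D a b \<Longrightarrow>
      g \<in> homset D b c \<Longrightarrow> g' \<in> homset D b c \<Longrightarrow>
      arr_le D f f' \<Longrightarrow> arr_le D g g' \<Longrightarrow> arr_le D (cmp D g f) (cmp D g' f')"

text \<open>Order-enriched functors from \<open>D\<close> to posets.\<close>

locale weight = order_enriched_category D
  for D :: "('o, 'm) ocat" and W :: "'o \<Rightarrow> 'w gorder" and Wm :: "'m \<Rightarrow> 'w \<Rightarrow> 'w" +
  assumes weight_poset: "d \<in> objs D \<Longrightarrow> partial_order (W d)"
    and weight_map: "n \<in> homset D d d' \<Longrightarrow>
      Wm n \<in> carrier (W d) \<rightarrow> carrier (W d') \<and> isotone (W d) (W d') (Wm n)"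
    and weight_ident: "d \<in> objs D \<Longrightarrow> x \<in> carrier (W d) \<Longrightarrow> Wm (ident D d) x = x"
    and weight_cmp: "n \<in> homset D d d' \<Longrightarrow> n' \<in> homset D d' d'' \<Longrightarrow> x \<in> carrier (W d) \<Longrightarrow>
      Wm (cmp D n' n) x = Wm n' (Wm n x)"
    and weight_mono: "n \<in> homset D d d' \<Longrightarrow> n' \<in> homset D d d' \<Longrightarrow> arr_le D n n' \<Longrightarrow>
      x \<in> carrier (W d) \<Longrightarrow> Wm n x \<sqsubseteq>\<^bsub>W d'\<^esub> Wm n' x"

text \<open>Order-enriched functors from \<open>D\<close> to the category \<open>C\<close>.\<close>

locale diagram = order_enriched_category D
  for C :: space_cat and D :: "('o, 'm) ocat"
    and F :: "'o \<Rightarrow> 'x topology" and Fm :: "'m \<Rightarrow> 'x \<Rightarrow> 'x" +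
  assumes diagram_obj: "d \<in> objs D \<Longrightarrow> in_cat C (F d)"
    and diagram_map: "n \<in> homset D d d' \<Longrightarrow> is_arrow C (F d) (F d') (Fm n)"
    and diagram_ident: "d \<in> objs D \<Longrightarrow> arrow_eq (F d) (Fm (ident D d)) id"
    and diagram_cmp: "n \<in> homset D d d' \<Longrightarrow> n' \<in> homset D d' d'' \<Longrightarrow>
      arrow_eq (F d) (Fm (cmp D n' n)) (Fm n' \<circ> Fm n)"
    and diagram_mono: "n \<in> homset D d d' \<Longrightarrow> n' \<in> homset D d d' \<Longrightarrow> arr_le D n n' \<Longrightarrow>
      arrow_le (F d) (F d') (Fm n) (Fm n')"

definition weighted_cone ::
    "space_cat \<Rightarrow> ('o, 'm) ocat \<Rightarrow> ('o \<Rightarrow> 'w gorder) \<Rightarrow> ('m \<Rightarrow> 'w \<Rightarrow> 'w) \<Rightarrow>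
     ('o \<Rightarrow> 'x topology) \<Rightarrow> ('m \<Rightarrow> 'x \<Rightarrow> 'x) \<Rightarrow>
     'a topology \<Rightarrow> ('o \<Rightarrow> 'w \<Rightarrow> 'a \<Rightarrow> 'x) \<Rightarrow> bool" where
  "weighted_cone C D W Wm F Fm A a \<longleftrightarrow>
     (\<forall>d\<in>objs D. \<forall>x\<in>carrier (W d). is_arrow C A (F d) (a d x)) \<and>
     (\<forall>d\<in>objs D. \<forall>x\<in>carrier (W d). \<forall>y\<in>carrier (W d).
        x \<sqsubseteq>\<^bsub>W d\<^esub> y \<longrightarrow> arrow_le A (F d) (a d x) (a d y)) \<and>
     (\<forall>d\<in>objs D. \<forall>d'\<in>objs D. \<forall>n\<in>homset D d d'. \<forall>x\<in>carrier (W d).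
        arrow_eq A (Fm n \<circ> a d x) (a d' (Wm n x)))"

text \<open>The universal property is stated for test objects \<open>A\<close> over a given type of points, as HOL
  does not allow quantification over types inside a definition.\<close>

definition weighted_limit ::
    "space_cat \<Rightarrow> 'a itself \<Rightarrow> ('o, 'm) ocat \<Rightarrow> ('o \<Rightarrow> 'w gorder) \<Rightarrow> ('m \<Rightarrow> 'w \<Rightarrow> 'w) \<Rightarrow>
     ('o \<Rightarrow> 'x topology) \<Rightarrow> ('m \<Rightarrow> 'x \<Rightarrow> 'x) \<Rightarrow>
     'l topology \<Rightarrow> ('o \<Rightarrow> 'w \<Rightarrow> 'l \<Rightarrow> 'x) \<Rightarrow> bool" where
  "weighted_limit C _ D W Wm F Fm L l \<longleftrightarrow>
     in_cat C L \<and> weighted_cone C D W Wm F Fm L l \<and>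
     (\<forall>A :: 'a topology. in_cat C A \<longrightarrow>
        (\<forall>a. weighted_cone C D W Wm F Fm A a \<longrightarrow>
           (\<exists>t. is_arrow C A L t \<and>
                (\<forall>d\<in>objs D. \<forall>x\<in>carrier (W d). arrow_eq A (a d x) (l d x \<circ> t)) \<and>
                (\<forall>t'. is_arrow C A L t' \<longrightarrow>
                   (\<forall>d\<in>objs D. \<forall>x\<in>carrier (W d). arrow_eq A (a d x) (l d x \<circ> t')) \<longrightarrow>
                   arrow_eq A t' t))) \<and>
        (\<forall>t t'. is_arrow C A L t \<longrightarrow> is_arrow C A L t' \<longrightarrow>
           (\<forall>d\<in>objs D. \<forall>x\<in>carrier (W d). arrow_le A (F d) (l d x \<circ> t) (l d x \<circ> t')) \<longrightarrow>
           arrow_le A L t t'))"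

text \<open>The type arguments are those of the objects and arrows of \<open>D\<close>, and of the points of the
  weight, of the spaces in the diagram, of the limit \<open>L\<close>, and of the test objects in the
  conclusion. For \<^const>\<open>Top0\<close> test objects over the point type of \<open>L\<close> suffice: a one-point
  test object shows that the points of \<open>L\<close> correspond to those of the canonical limit (the
  compatible families), whose topology can then be transported to \<open>L\<close> and serve as a test
  object itself. So the hypothesis below already says that \<open>L\<close> is a limit in the whole of
  \<^const>\<open>Top0\<close>, whereas the conclusion concerns test objects over an arbitrary type.\<close>

definition closed_under_weighted_limits ::
    "space_cat \<Rightarrow> ('o \<times> 'm \<times> 'w \<times> 'x \<times> 'l \<times> 'a) itself \<Rightarrow> bool" where
  "closed_under_weighted_limits C _ \<longleftrightarrow>
     (\<forall>(D :: ('o, 'm) ocat) (W :: 'o \<Rightarrow> 'w gorder) Wm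
       (F :: 'o \<Rightarrow> 'x topology) Fm (L :: 'l topology) l.
        weight D W Wm \<longrightarrow> diagram C D F Fm \<longrightarrow>
        weighted_limit Top0 TYPE('l) D W Wm F Fm L l \<longrightarrow>
        weighted_limit C TYPE('a) D W Wm F Fm L l)"

end

theory Submission
  imports Defs
begin

text \<open>Testing a limit \<open>L\<close> in \<open>Top0\<close> against a one-point space and against its own points with the
  initial topology shows that its points are the compatible families and that its topology is
  initial. For domains, directed suprema and (non-empty) infima of compatible families are
  then computed pointwise; the infima of the sets of all \<open>q\<close> with \<open>c \<le> l i q\<close> for finitely many
  pairs of an index \<open>i\<close> and a compact element \<open>c\<close> are compact elements of \<open>L\<close>, and there are enough
  of them to make \<open>L\<close> algebraic and its topology the Scott topology. For spectral spaces, the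
  compatible families form a closed subset of the product of the patch topologies, which is
  compact by Tychonoff; the resulting compact topology on \<open>L\<close> makes it spectral.\<close>

text \<open>The universal property of \<open>L\<close> is given for test objects over its own point
  type only, and it says nothing about arrows of the smaller category. So maps into \<open>L\<close>
  from other spaces are built point by point from the concrete description of \<open>L\<close>, and
  being an arrow is then checked coordinatewise. In the domain case, compactness is not
  coordinatewise: in an infinite product a point with compact coordinates need not be compact. The
  compact elements used come from partial left adjoints of the projections: the infimum
  \<open>b\<close> of all \<open>q\<close> with \<open>c \<le> l i q\<close> satisfies
  \<open>b \<le> q\<close> iff \<open>c \<le> l i q\<close>. It exists because non-empty infima are
  pointwise, and it is compact because directed suprema are. In the spectral case, the original
  topologies do not make the compatible families closed, since a specialisation order is in general
  not closed in the square of its space; it is closed for the patch topologies. As \<open>L\<close>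
  is not yet known to be spectral, its compact topology has to come from the product of the patches,
  and its properties are then transferred back to \<open>L\<close>.\<close>

section \<open>The specialisation order\<close>

abbreviation spec_le :: "'a topology \<Rightarrow> 'a \<Rightarrow> 'a \<Rightarrow> bool" where
  "spec_le X x y \<equiv> x \<sqsubseteq>\<^bsub>specialisation X\<^esub> y"

lemma carrier_specialisation [simp]: "carrier (specialisation X) = topspace X"
  by (simp add: specialisation_def)

lemma spec_le_iff: "spec_le X x y \<longleftrightarrow> (\<forall>U. openin X U \<longrightarrow> x \<in> U \<longrightarrow> y \<in> U)"
  by (simp add: specialisation_def)

lemma spec_le_refl: "spec_le X x x"
  by (simp add: spec_le_iff)

lemma spec_le_trans: "spec_le X x y \<Longrightarrow> spec_le X y z \<Longrightarrow> spec_le X x z"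
  by (simp add: spec_le_iff)

lemma spec_le_antisym:
  assumes "t0_space X" "x \<in> topspace X" "y \<in> topspace X" "spec_le X x y" "spec_le X y x"
  shows "x = y"
  using assms unfolding t0_space_def spec_le_iff by metis

lemma partial_order_specialisation:
  assumes "t0_space X"
  shows "partial_order (specialisation X)"
proof unfold_locales
  fix x y
  assume "spec_le X x y" "spec_le X y x" "x \<in> carrier (specialisation X)" "y \<in> carrier (specialisation X)"
  then have "x = y"
    using spec_le_antisym[OF assms] by simp
  then show "x .=\<^bsub>specialisation X\<^esub> y" by (simp add: specialisation_def)
next
  fix x y z assume "spec_le X x y" "spec_le X y z"
  then show "spec_le X x z" by (rule spec_le_trans)
qed (simp_all add: specialisation_def)

lemma t0_space_if_partial_order:
  assumes "partial_order (specialisation X)"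
  shows "t0_space X"
proof -
  interpret partial_order "specialisation X" by fact
  show ?thesis
    unfolding t0_space_def
  proof (intro ballI impI, rule ccontr)
    fix x y assume xy: "x \<in> topspace X" "y \<in> topspace X" "x \<noteq> y"
      and "\<not> (\<exists>U. openin X U \<and> (x \<notin> U) = (y \<in> U))"
    then have "spec_le X x y" "spec_le X y x" by (auto simp: spec_le_iff)
    then show False using le_antisym[of x y] xy by simp
  qed
qed

lemma spec_le_continuous:
  assumes "continuous_map X Y f" "x \<in> topspace X" "spec_le X x y"
  shows "spec_le Y (f x) (f y)"
  unfolding spec_le_iff
proof (intro allI impI)
  fix U assume "openin Y U" "f x \<in> U"
  then have "openin X {z \<in> topspace X. f z \<in> U}" "x \<in> {z \<in> topspace X. f z \<in> U}"
    using assms openin_continuous_map_preimage by auto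
  then show "f y \<in> U" using assms(3) unfolding spec_le_iff by blast
qed

lemma is_lub_specialisation:
  assumes "S \<subseteq> topspace X"
  shows "is_lub (specialisation X) s S \<longleftrightarrow> s \<in> topspace X \<and> (\<forall>x\<in>S. spec_le X x s) \<and>
    (\<forall>u\<in>topspace X. (\<forall>x\<in>S. spec_le X x u) \<longrightarrow> spec_le X s u)"
proof -
  have "Upper (specialisation X) S = {u \<in> topspace X. \<forall>x\<in>S. spec_le X x u}"
    using assms by (auto simp: Upper_def)
  then show ?thesis by (auto simp: least_def)
qed

lemma is_glb_specialisation:
  assumes "S \<subseteq> topspace X"
  shows "is_glb (specialisation X) s S \<longleftrightarrow> s \<in> topspace X \<and> (\<forall>x\<in>S. spec_le X s x) \<and>
    (\<forall>u\<in>topspace X. (\<forall>x\<in>S. spec_le X u x) \<longrightarrow> spec_le X u s)"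
proof -
  have "Lower (specialisation X) S = {u \<in> topspace X. \<forall>x\<in>S. spec_le X u x}"
    using assms by (auto simp: Lower_def)
  then show ?thesis by (auto simp: greatest_def)
qed

text \<open>A comparable pair \<open>{x, y}\<close> is directed with supremum \<open>y\<close>, so
  monotonicity is a special case of preservation.\<close>

lemma preserves_directed_sups_mono:
  assumes "preserves_directed_sups (specialisation X) (specialisation Y) f"
    and "x \<in> topspace X" "y \<in> topspace X" "spec_le X x y"
  shows "spec_le Y (f x) (f y)"
proof -
  have "directed_in (specialisation X) {x, y}"
    using assms(2-4) by (auto simp: directed_in_def spec_le_refl)
  moreover have "is_lub (specialisation X) y {x, y}"
    using assms(2-4) by (auto simp: is_lub_specialisation spec_le_refl)
  ultimately have "is_lub (specialisation Y) (f y) (f ` {x, y})"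
    using assms(1) unfolding preserves_directed_sups_def by blast
  moreover have "f ` {x, y} \<subseteq> topspace Y"
    using assms(1-3) by (auto simp: preserves_directed_sups_def)
  ultimately show ?thesis by (simp add: is_lub_specialisation)
qed

lemma directed_in_image:
  assumes "directed_in (specialisation X) D" "f \<in> topspace X \<rightarrow> topspace Y"
    and "\<And>x y. x \<in> topspace X \<Longrightarrow> y \<in> topspace X \<Longrightarrow> spec_le X x y \<Longrightarrow> spec_le Y (f x) (f y)"
  shows "directed_in (specialisation Y) (f ` D)"
  using assms unfolding directed_in_def by simp (blast 10)

text \<open>Induction on \<open>E\<close>; directed sets are non-empty by definition, which supplies
  the bound for \<open>E = {}\<close>.\<close>

lemma directed_in_finite_bound:
  assumes "directed_in (specialisation X) D" "finite E" "E \<subseteq> D"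
  obtains d where "d \<in> D" "\<forall>e\<in>E. spec_le X e d"
proof -
  from assms(2,3) have "\<exists>d\<in>D. \<forall>e\<in>E. spec_le X e d"
  proof (induction E)
    case empty
    then show ?case using assms(1) by (auto simp: directed_in_def)
  next
    case (insert a E)
    then obtain d where "d \<in> D" "\<forall>e\<in>E. spec_le X e d" by auto
    moreover obtain d' where "d' \<in> D" "spec_le X a d'" "spec_le X d d'"
      using assms(1) insert.prems \<open>d \<in> D\<close> unfolding directed_in_def by blast
    ultimately show ?case by (auto intro: spec_le_trans)
  qed
  with that show thesis by blast
qed

text \<open>Compactness of \<open>c\<close> says precisely that its principal upper set cannot be
  reached by a directed supremum from outside, so that set is Scott open.\<close>

lemma openin_above_compact_element:
  assumes "X = scott_topology (specialisation X)" "compact_element (specialisation X) c"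
  shows "openin X {x \<in> topspace X. spec_le X c x}"
proof -
  have "scott_open (specialisation X) {x \<in> topspace X. spec_le X c x}"
    unfolding scott_open_def
  proof (intro conjI allI impI ballI)
    fix D s
    assume D: "directed_in (specialisation X) D" "is_lub (specialisation X) s D"
      and "s \<in> {x \<in> topspace X. spec_le X c x}"
    then obtain d where "d \<in> D" "spec_le X c d"
      using assms(2) unfolding compact_element_def by blast
    then show "D \<inter> {x \<in> topspace X. spec_le X c x} \<noteq> {}"
      using D(1) unfolding directed_in_def by auto
  next
    fix x y
    assume "x \<in> {x \<in> topspace X. spec_le X c x}" "y \<in> carrier (specialisation X)" "spec_le X x y"
    then show "y \<in> {x \<in> topspace X. spec_le X c x}"
      using spec_le_trans[of X c x y] by simp
  qed auto
  then show ?thesis using assms(1) by (metis openin_scott_topology)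
qed

text \<open>The infimum is the supremum of the set of lower bounds, and any member of
  \<open>S\<close> bounds that set from above; this is where \<open>S\<close> must be
  non-empty.\<close>

lemma bounded_complete_glb:
  assumes "bounded_complete (specialisation X)" "S \<subseteq> topspace X" "S \<noteq> {}"
  shows "\<exists>i. is_glb (specialisation X) i S"
proof -
  let ?B = "{u \<in> topspace X. \<forall>x\<in>S. spec_le X u x}"
  from assms(2,3) obtain x where "x \<in> S" "x \<in> topspace X" by blast
  then have "x \<in> Upper (specialisation X) ?B" by (auto simp: Upper_def)
  with assms(1) obtain s where "is_lub (specialisation X) s ?B"
    unfolding bounded_complete_def by (metis (no_types, lifting) carrier_specialisation empty_iff mem_Collect_eq subsetI)
  then have s: "s \<in> topspace X" "\<forall>x\<in>?B. spec_le X x s"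
      "\<forall>u\<in>topspace X. (\<forall>x\<in>?B. spec_le X x u) \<longrightarrow> spec_le X s u"
    by (simp_all add: is_lub_specialisation)
  then have "is_glb (specialisation X) s S"
    using assms(2) by (simp add: is_glb_specialisation subset_iff)
  then show ?thesis by blast
qed

text \<open>Dually, a supremum is the infimum of the upper bounds, a non-empty set exactly when
  \<open>S\<close> is bounded.\<close>

lemma bounded_complete_if_glb:
  assumes "\<And>S. S \<subseteq> topspace X \<Longrightarrow> S \<noteq> {} \<Longrightarrow> \<exists>i. is_glb (specialisation X) i S"
  shows "bounded_complete (specialisation X)"
  unfolding bounded_complete_def
proof (intro allI impI)
  fix S assume S: "S \<subseteq> carrier (specialisation X)" "Upper (specialisation X) S \<noteq> {}"
  then have *: "Upper (specialisation X) S = {u \<in> topspace X. \<forall>x\<in>S. spec_le X x u}"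
    by (auto simp: Upper_def)
  with assms[of "Upper (specialisation X) S"] S(2)
  obtain i where "is_glb (specialisation X) i {u \<in> topspace X. \<forall>x\<in>S. spec_le X x u}" by auto
  then have "is_lub (specialisation X) i S"
    using S(1) by (simp add: is_lub_specialisation is_glb_specialisation subset_iff)
  then show "\<exists>s. is_lub (specialisation X) s S" by blast
qed

section \<open>Initial topologies cut out by inequalities\<close>

text \<open>Restricting to \<open>I\<close> yields extensional functions, as the points of
  \<open>product_topology\<close> are.\<close>

definition tuple :: "'i set \<Rightarrow> ('i \<Rightarrow> 'l \<Rightarrow> 'x) \<Rightarrow> 'l \<Rightarrow> 'i \<Rightarrow> 'x" where
  "tuple I l p = (\<lambda>i\<in>I. l i p)"

text \<open>Universal property of an initial topology. It serves the topology of \<open>L\<close> as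
  well as the patch topology put on its points later.\<close>

lemma continuous_map_tuple:
  assumes t: "t \<in> topspace A \<rightarrow> S"
    and a: "\<And>i. i \<in> I \<Longrightarrow> continuous_map A (Y i) (a i)"
    and eq: "\<And>i p. i \<in> I \<Longrightarrow> p \<in> topspace A \<Longrightarrow> a i p = l i (t p)"
  shows "continuous_map A (pullback_topology S (tuple I l) (product_topology Y I)) t"
proof (rule continuous_map_pullback')
  have "continuous_map A (product_topology Y I) (\<lambda>x. \<lambda>i\<in>I. a i x)"
    by (auto simp: continuous_map_componentwise a)
  then show "continuous_map A (product_topology Y I) (tuple I l \<circ> t)"
    by (rule continuous_map_eq) (auto simp: tuple_def eq)
qed (use t in blast)

lemma continuous_map_pullback_tuple:
  assumes "i \<in> I"
  shows "continuous_map (pullback_topology S (tuple I l) (product_topology Y I)) (Y i) (l i)"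
proof -
  have "continuous_map (pullback_topology S (tuple I l) (product_topology Y I)) (Y i)
      ((\<lambda>\<phi>. \<phi> i) \<circ> tuple I l)"
    by (rule continuous_map_pullback) (rule continuous_map_product_projection[OF assms])
  then show ?thesis
    by (rule continuous_map_eq) (simp add: tuple_def assms)
qed

text \<open>Monotonicity of a weighted cone in the weight and its compatibility with the arrows of
  the diagram are both instances of inequalities \<open>f (l i p) \<le> g (l j p)\<close> (an equation being two
  inequalities), where \<open>f\<close> and \<open>g\<close> are arrows into a third space of the family.\<close>

locale inserter =
  fixes I :: "'i set" and X :: "'i \<Rightarrow> 'x topology"
    and R :: "('i \<times> 'i \<times> 'i \<times> ('x \<Rightarrow> 'x) \<times> ('x \<Rightarrow> 'x)) set"
    and L :: "'l topology" and l :: "'i \<Rightarrow> 'l \<Rightarrow> 'x"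
  assumes t0: "i \<in> I \<Longrightarrow> t0_space (X i)"
    and indices: "(i, j, k, f, g) \<in> R \<Longrightarrow> i \<in> I \<and> j \<in> I \<and> k \<in> I"
    and initial: "L = pullback_topology (topspace L) (tuple I l) (product_topology X I)"
    and proj: "i \<in> I \<Longrightarrow> p \<in> topspace L \<Longrightarrow> l i p \<in> topspace (X i)"
    and inj: "p \<in> topspace L \<Longrightarrow> q \<in> topspace L \<Longrightarrow> (\<And>i. i \<in> I \<Longrightarrow> l i p = l i q) \<Longrightarrow> p = q"
    and constraint: "(i, j, k, f, g) \<in> R \<Longrightarrow> p \<in> topspace L \<Longrightarrow>
      spec_le (X k) (f (l i p)) (g (l j p))"
    and surj: "(\<And>i. i \<in> I \<Longrightarrow> s i \<in> topspace (X i)) \<Longrightarrow>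
      (\<And>i j k f g. (i, j, k, f, g) \<in> R \<Longrightarrow> spec_le (X k) (f (s i)) (g (s j))) \<Longrightarrow>
      \<exists>p\<in>topspace L. \<forall>i\<in>I. l i p = s i"
begin

lemma continuous_proj: "i \<in> I \<Longrightarrow> continuous_map L (X i) (l i)"
  by (subst initial) (rule continuous_map_pullback_tuple)

text \<open>Basic neighbourhoods are boxes with finitely many proper sides. This finiteness is what
  later allows one upper bound in a directed set, or one finite intersection of compact opens, to
  handle all coordinates.\<close>

lemma openinE:
  assumes "openin L U" "p \<in> U"
  obtains V where "finite {i \<in> I. V i \<noteq> topspace (X i)}" "\<And>i. i \<in> I \<Longrightarrow> openin (X i) (V i)"
    "\<And>i. i \<in> I \<Longrightarrow> l i p \<in> V i"
    "\<And>q. q \<in> topspace L \<Longrightarrow> (\<And>i. i \<in> I \<Longrightarrow> l i q \<in> V i) \<Longrightarrow> q \<in> U"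
proof -
  from assms(1) initial obtain B where B: "openin (product_topology X I) B"
    and U: "U = tuple I l -` B \<inter> topspace L"
    by (metis openin_pullback_topology)
  with assms(2) have "tuple I l p \<in> B" by blast
  with B obtain V where V: "finite {i \<in> I. V i \<noteq> topspace (X i)}" "\<forall>i\<in>I. openin (X i) (V i)"
    "tuple I l p \<in> Pi\<^sub>E I V" "Pi\<^sub>E I V \<subseteq> B"
    unfolding openin_product_topology_alt by blast
  show thesis
  proof
    show "l i p \<in> V i" if "i \<in> I" for i
      using PiE_mem[OF V(3) that] that by (simp add: tuple_def)
    show "q \<in> U" if "q \<in> topspace L" "\<And>i. i \<in> I \<Longrightarrow> l i q \<in> V i" for q
    proof -
      have "tuple I l q \<in> Pi\<^sub>E I V" using that by (auto simp: tuple_def)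
      then show ?thesis using U V(4) that by blast
    qed
  qed (use V in auto)
qed

text \<open>Continuity of the projections gives one direction; the other holds because the sides of
  a basic box are upper sets.\<close>

lemma spec_le_limit_iff:
  assumes "p \<in> topspace L" "q \<in> topspace L"
  shows "spec_le L p q \<longleftrightarrow> (\<forall>i\<in>I. spec_le (X i) (l i p) (l i q))"
proof
  assume "spec_le L p q"
  then show "\<forall>i\<in>I. spec_le (X i) (l i p) (l i q)"
    using assms spec_le_continuous continuous_proj by metis
next
  assume le: "\<forall>i\<in>I. spec_le (X i) (l i p) (l i q)"
  show "spec_le L p q"
    unfolding spec_le_iff
  proof (intro allI impI)
    fix U assume "openin L U" "p \<in> U"
    then obtain V where "\<And>i. i \<in> I \<Longrightarrow> openin (X i) (V i)" "\<And>i. i \<in> I \<Longrightarrow> l i p \<in> V i"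
      "\<And>q. q \<in> topspace L \<Longrightarrow> (\<And>i. i \<in> I \<Longrightarrow> l i q \<in> V i) \<Longrightarrow> q \<in> U"
      by (rule openinE) blast
    then show "q \<in> U" using le assms by (metis spec_le_iff)
  qed
qed

lemma t0_limit: "t0_space L"
proof -
  have "p = q" if "p \<in> topspace L" "q \<in> topspace L" "spec_le L p q" "spec_le L q p" for p q
  proof (rule inj[OF that(1,2)])
    fix i assume "i \<in> I"
    with that show "l i p = l i q"
      by (intro spec_le_antisym[OF t0[of i]]) (auto simp: spec_le_limit_iff proj)
  qed
  then show ?thesis
    unfolding t0_space_def spec_le_iff by blast
qed

lemma image_proj_subset: "i \<in> I \<Longrightarrow> S \<subseteq> topspace L \<Longrightarrow> l i ` S \<subseteq> topspace (X i)"
  using proj by blast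

text \<open>Immediate from the pointwise order, as bounds in \<open>L\<close> project to bounds.
  That coordinatewise suprema assemble to a point of \<open>L\<close> is a separate matter, settled
  by \<open>ex_pointwise_lub\<close>.\<close>

lemma is_lub_pointwise:
  assumes "S \<subseteq> topspace L" "p \<in> topspace L"
    and "\<And>i. i \<in> I \<Longrightarrow> is_lub (specialisation (X i)) (l i p) (l i ` S)"
  shows "is_lub (specialisation L) p S"
proof -
  have "(\<forall>q\<in>S. spec_le (X i) (l i q) (l i p)) \<and>
      (\<forall>u\<in>topspace (X i). (\<forall>q\<in>S. spec_le (X i) (l i q) u) \<longrightarrow> spec_le (X i) (l i p) u)"
    if "i \<in> I" for i
    using assms(3)[OF that] by (simp add: is_lub_specialisation image_proj_subset assms that)
  then show ?thesis
    using assms(1,2) by (auto simp: is_lub_specialisation spec_le_limit_iff subset_iff proj)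
qed

lemma is_glb_pointwise:
  assumes "S \<subseteq> topspace L" "p \<in> topspace L"
    and "\<And>i. i \<in> I \<Longrightarrow> is_glb (specialisation (X i)) (l i p) (l i ` S)"
  shows "is_glb (specialisation L) p S"
proof -
  have "(\<forall>q\<in>S. spec_le (X i) (l i p) (l i q)) \<and>
      (\<forall>u\<in>topspace (X i). (\<forall>q\<in>S. spec_le (X i) u (l i q)) \<longrightarrow> spec_le (X i) u (l i p))"
    if "i \<in> I" for i
    using assms(3)[OF that] by (simp add: is_glb_specialisation image_proj_subset assms that)
  then show ?thesis
    using assms(1,2) by (auto simp: is_glb_specialisation spec_le_limit_iff subset_iff proj)
qed

text \<open>For a constraint with maps \<open>f\<close> and \<open>g\<close>, the value of
  \<open>f\<close> at the supremum is the supremum of the \<open>f (l i q)\<close>, and each of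
  these is below \<open>g (l j q)\<close>, hence below the value of \<open>g\<close> at the
  supremum. So \<open>f\<close> has to preserve the supremum, while \<open>g\<close> enters only
  through monotonicity.\<close>

lemma ex_pointwise_lub:
  assumes S: "S \<subseteq> topspace L"
    and ex: "\<And>i. i \<in> I \<Longrightarrow> \<exists>s. is_lub (specialisation (X i)) s (l i ` S)"
    and f: "\<And>i j k f g s. (i, j, k, f, g) \<in> R \<Longrightarrow> is_lub (specialisation (X i)) s (l i ` S) \<Longrightarrow>
      is_lub (specialisation (X k)) (f s) (f ` l i ` S)"
    and f_fun: "\<And>i j k f g. (i, j, k, f, g) \<in> R \<Longrightarrow> f \<in> topspace (X i) \<rightarrow> topspace (X k)"
    and g_fun: "\<And>i j k f g. (i, j, k, f, g) \<in> R \<Longrightarrow> g \<in> topspace (X j) \<rightarrow> topspace (X k)"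
    and g: "\<And>i j k f g x y. (i, j, k, f, g) \<in> R \<Longrightarrow> x \<in> topspace (X j) \<Longrightarrow> y \<in> topspace (X j) \<Longrightarrow>
      spec_le (X j) x y \<Longrightarrow> spec_le (X k) (g x) (g y)"
  shows "\<exists>p\<in>topspace L. \<forall>i\<in>I. is_lub (specialisation (X i)) (l i p) (l i ` S)"
proof -
  from ex obtain s where s: "\<And>i. i \<in> I \<Longrightarrow> is_lub (specialisation (X i)) (s i) (l i ` S)"
    by metis
  then have s': "s i \<in> topspace (X i) \<and> (\<forall>q\<in>S. spec_le (X i) (l i q) (s i))" if "i \<in> I" for i
    using that S by (simp add: is_lub_specialisation image_proj_subset)
  have "\<exists>p\<in>topspace L. \<forall>i\<in>I. l i p = s i"
  proof (rule surj)
    fix i j k f' g' assume r: "(i, j, k, f', g') \<in> R"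
    note ijk = indices[OF r]
    have "f' ` l i ` S \<subseteq> topspace (X k)"
      using f_fun[OF r] proj ijk S by blast
    with f[OF r] s[of i] ijk
    have lub: "\<And>u. u \<in> topspace (X k) \<Longrightarrow> (\<And>q. q \<in> S \<Longrightarrow> spec_le (X k) (f' (l i q)) u) \<Longrightarrow>
        spec_le (X k) (f' (s i)) u"
      by (simp add: is_lub_specialisation)
    show "spec_le (X k) (f' (s i)) (g' (s j))"
    proof (rule lub)
      show "g' (s j) \<in> topspace (X k)" using g_fun[OF r] s' ijk by blast
      fix q assume q: "q \<in> S"
      then have "q \<in> topspace L" using S by blast
      then have "spec_le (X k) (f' (l i q)) (g' (l j q))" using constraint[OF r] by blast
      moreover have "spec_le (X k) (g' (l j q)) (g' (s j))"
        using g[OF r] s' ijk q proj \<open>q \<in> topspace L\<close> by blast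
      ultimately show "spec_le (X k) (f' (l i q)) (g' (s j))" by (rule spec_le_trans)
    qed
  qed (use s' in blast)
  with s show ?thesis by metis
qed

text \<open>Dual argument with the roles exchanged: now \<open>g\<close> has to preserve the infimum
  and \<open>f\<close> has to be monotone.\<close>

lemma ex_pointwise_glb:
  assumes S: "S \<subseteq> topspace L"
    and ex: "\<And>i. i \<in> I \<Longrightarrow> \<exists>s. is_glb (specialisation (X i)) s (l i ` S)"
    and g: "\<And>i j k f g s. (i, j, k, f, g) \<in> R \<Longrightarrow> is_glb (specialisation (X j)) s (l j ` S) \<Longrightarrow>
      is_glb (specialisation (X k)) (g s) (g ` l j ` S)"
    and f_fun: "\<And>i j k f g. (i, j, k, f, g) \<in> R \<Longrightarrow> f \<in> topspace (X i) \<rightarrow> topspace (X k)"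
    and g_fun: "\<And>i j k f g. (i, j, k, f, g) \<in> R \<Longrightarrow> g \<in> topspace (X j) \<rightarrow> topspace (X k)"
    and f: "\<And>i j k f g x y. (i, j, k, f, g) \<in> R \<Longrightarrow> x \<in> topspace (X i) \<Longrightarrow> y \<in> topspace (X i) \<Longrightarrow>
      spec_le (X i) x y \<Longrightarrow> spec_le (X k) (f x) (f y)"
  shows "\<exists>p\<in>topspace L. \<forall>i\<in>I. is_glb (specialisation (X i)) (l i p) (l i ` S)"
proof -
  from ex obtain s where s: "\<And>i. i \<in> I \<Longrightarrow> is_glb (specialisation (X i)) (s i) (l i ` S)"
    by metis
  then have s': "s i \<in> topspace (X i) \<and> (\<forall>q\<in>S. spec_le (X i) (s i) (l i q))" if "i \<in> I" for i
    using that S by (simp add: is_glb_specialisation image_proj_subset)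
  have "\<exists>p\<in>topspace L. \<forall>i\<in>I. l i p = s i"
  proof (rule surj)
    fix i j k f' g' assume r: "(i, j, k, f', g') \<in> R"
    note ijk = indices[OF r]
    have "g' ` l j ` S \<subseteq> topspace (X k)"
      using g_fun[OF r] proj ijk S by blast
    with g[OF r] s[of j] ijk
    have glb: "\<And>u. u \<in> topspace (X k) \<Longrightarrow> (\<And>q. q \<in> S \<Longrightarrow> spec_le (X k) u (g' (l j q))) \<Longrightarrow>
        spec_le (X k) u (g' (s j))"
      by (simp add: is_glb_specialisation)
    show "spec_le (X k) (f' (s i)) (g' (s j))"
    proof (rule glb)
      show "f' (s i) \<in> topspace (X k)" using f_fun[OF r] s' ijk by blast
      fix q assume q: "q \<in> S"
      then have "q \<in> topspace L" using S by blast
      then have "spec_le (X k) (f' (l i q)) (g' (l j q))" using constraint[OF r] by blast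
      moreover have "spec_le (X k) (f' (s i)) (f' (l i q))"
        using f[OF r] s' ijk q proj \<open>q \<in> topspace L\<close> by blast
      ultimately show "spec_le (X k) (f' (s i)) (g' (l j q))" by (metis spec_le_trans)
    qed
  qed (use s' in blast)
  with s show ?thesis by metis
qed

end

section \<open>Bounded complete algebraic domains\<close>

locale domain_inserter = inserter +
  assumes domain: "i \<in> I \<Longrightarrow> in_cat ADom (X i)"
    and arrow: "(i, j, k, f, g) \<in> R \<Longrightarrow> is_arrow ADom (X i) (X k) f \<and> is_arrow ADom (X j) (X k) g"
begin

lemma arrow_mono:
  assumes "(i, j, k, f, g) \<in> R"
  shows "f \<in> topspace (X i) \<rightarrow> topspace (X k)" "g \<in> topspace (X j) \<rightarrow> topspace (X k)"
    and "\<And>x y. x \<in> topspace (X i) \<Longrightarrow> y \<in> topspace (X i) \<Longrightarrow> spec_le (X i) x y \<Longrightarrow>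
      spec_le (X k) (f x) (f y)"
    and "\<And>x y. x \<in> topspace (X j) \<Longrightarrow> y \<in> topspace (X j) \<Longrightarrow> spec_le (X j) x y \<Longrightarrow>
      spec_le (X k) (g x) (g y)"
proof -
  have "preserves_directed_sups (specialisation (X i)) (specialisation (X k)) f"
    "preserves_directed_sups (specialisation (X j)) (specialisation (X k)) g"
    using arrow[OF assms] by simp_all
  note this this[THEN preserves_directed_sups_mono]
  then show "f \<in> topspace (X i) \<rightarrow> topspace (X k)" "g \<in> topspace (X j) \<rightarrow> topspace (X k)"
    "\<And>x y. x \<in> topspace (X i) \<Longrightarrow> y \<in> topspace (X i) \<Longrightarrow> spec_le (X i) x y \<Longrightarrow>
      spec_le (X k) (f x) (f y)"
    "\<And>x y. x \<in> topspace (X j) \<Longrightarrow> y \<in> topspace (X j) \<Longrightarrow> spec_le (X j) x y \<Longrightarrow>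
      spec_le (X k) (g x) (g y)"
    by (simp_all add: preserves_directed_sups_def)
qed

lemma directed_in_proj:
  assumes "i \<in> I" "directed_in (specialisation L) D"
  shows "directed_in (specialisation (X i)) (l i ` D)"
  using assms(2)
proof (rule directed_in_image)
  show "l i \<in> topspace L \<rightarrow> topspace (X i)" using proj[OF assms(1)] by blast
qed (use assms(1) spec_le_limit_iff in blast)

lemma ex_directed_lub:
  assumes D: "directed_in (specialisation L) D"
  shows "\<exists>p\<in>topspace L. \<forall>i\<in>I. is_lub (specialisation (X i)) (l i p) (l i ` D)"
proof (rule ex_pointwise_lub)
  show "D \<subseteq> topspace L" using D by (simp add: directed_in_def)
  show "\<exists>s. is_lub (specialisation (X i)) s (l i ` D)" if "i \<in> I" for i
    using domain[OF that] directed_in_proj[OF that D] by (simp add: algebraic_domain_def dcpo_def)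
  show "is_lub (specialisation (X k)) (f s) (f ` l i ` D)"
    if "(i, j, k, f, g) \<in> R" "is_lub (specialisation (X i)) s (l i ` D)" for i j k f g s
    using arrow[OF that(1)] that(2) directed_in_proj[OF _ D, of i] indices[OF that(1)]
    by (simp add: preserves_directed_sups_def)
qed (fact arrow_mono)+

lemma ex_nonempty_glb:
  assumes S: "S \<subseteq> topspace L" "S \<noteq> {}"
  shows "\<exists>p\<in>topspace L. \<forall>i\<in>I. is_glb (specialisation (X i)) (l i p) (l i ` S)"
proof (rule ex_pointwise_glb[OF S(1)])
  show "\<exists>s. is_glb (specialisation (X i)) s (l i ` S)" if "i \<in> I" for i
    using bounded_complete_glb[of "X i" "l i ` S"] domain[OF that] image_proj_subset[OF that S(1)] S(2)
    by simp
  show "is_glb (specialisation (X k)) (g s) (g ` l j ` S)"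
    if "(i, j, k, f, g) \<in> R" "is_glb (specialisation (X j)) s (l j ` S)" for i j k f g s
    using arrow[OF that(1)] that(2) image_proj_subset[OF _ S(1), of j] indices[OF that(1)] S(2)
    by (simp add: preserves_nonempty_infs_def)
qed (fact arrow_mono)+

lemma partial_order_limit: "partial_order (specialisation L)"
  by (rule partial_order_specialisation[OF t0_limit])

text \<open>A given supremum in \<open>L\<close> equals the coordinatewise one by uniqueness of
  suprema, and the latter is preserved by construction.\<close>

lemma proj_preserves_directed_sups:
  assumes i: "i \<in> I"
  shows "preserves_directed_sups (specialisation L) (specialisation (X i)) (l i)"
  unfolding preserves_directed_sups_def
proof (intro conjI allI impI)
  show "l i \<in> carrier (specialisation L) \<rightarrow> carrier (specialisation (X i))"
    using proj[OF i] by simp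
  fix D s assume D: "directed_in (specialisation L) D" and s: "is_lub (specialisation L) s D"
  from ex_directed_lub[OF D] obtain p where p: "p \<in> topspace L"
    "\<forall>i\<in>I. is_lub (specialisation (X i)) (l i p) (l i ` D)" by blast
  have "is_lub (specialisation L) p D"
    by (rule is_lub_pointwise) (use D p in \<open>auto simp: directed_in_def\<close>)
  then have "p = s"
    using s partial_order.least_unique[OF partial_order_limit] by metis
  then show "is_lub (specialisation (X i)) (l i s) (l i ` D)" using p i by blast
qed

lemma proj_preserves_nonempty_infs:
  assumes i: "i \<in> I"
  shows "preserves_nonempty_infs (specialisation L) (specialisation (X i)) (l i)"
  unfolding preserves_nonempty_infs_def
proof (intro conjI allI impI)
  show "l i \<in> carrier (specialisation L) \<rightarrow> carrier (specialisation (X i))"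
    using proj[OF i] by simp
  fix S s assume S: "S \<subseteq> carrier (specialisation L)" "S \<noteq> {}" and s: "is_glb (specialisation L) s S"
  then have "S \<subseteq> topspace L" by simp
  from ex_nonempty_glb[OF this S(2)] obtain p where p: "p \<in> topspace L"
    "\<forall>i\<in>I. is_glb (specialisation (X i)) (l i p) (l i ` S)" by blast
  have "is_glb (specialisation L) p S"
    by (rule is_glb_pointwise) (use S p in auto)
  then have "p = s"
    using s partial_order.greatest_unique[OF partial_order_limit] by metis
  then show "is_glb (specialisation (X i)) (l i s) (l i ` S)" using p i by blast
qed

lemma ex_glb:
  assumes "S \<subseteq> topspace L" "S \<noteq> {}"
  shows "\<exists>p. is_glb (specialisation L) p S"
proof -
  from ex_nonempty_glb[OF assms] obtain p where p: "p \<in> topspace L"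
    "\<forall>i\<in>I. is_glb (specialisation (X i)) (l i p) (l i ` S)" by blast
  have "is_glb (specialisation L) p S"
    by (rule is_glb_pointwise) (use assms p in auto)
  then show ?thesis by blast
qed

lemma dcpo_limit: "dcpo (specialisation L)"
  unfolding dcpo_def
proof (intro conjI partial_order_limit allI impI)
  fix D assume D: "directed_in (specialisation L) D"
  from ex_directed_lub[OF D] obtain p where p: "p \<in> topspace L"
    "\<forall>i\<in>I. is_lub (specialisation (X i)) (l i p) (l i ` D)" by blast
  have "is_lub (specialisation L) p D"
    by (rule is_lub_pointwise) (use D p in \<open>auto simp: directed_in_def\<close>)
  then show "\<exists>s. is_lub (specialisation L) s D" by blast
qed

section \<open>Compact elements of the limit\<close>

definition above :: "('a \<times> 'b) set \<Rightarrow> 'c set" where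
  "above M = {q \<in> topspace L. \<forall>(i, c)\<in>M. spec_le (X i) c (l i q)}"

definition compact_below :: "'c \<Rightarrow> ('a \<times> 'b) set" where
  "compact_below p = {(i, c). i \<in> I \<and> compact_element (specialisation (X i)) c \<and> spec_le (X i) c (l i p)}"

text \<open>For \<open>M = {(i, c)}\<close> the infimum is the value at \<open>c\<close> of a
  partial left adjoint of \<open>l i\<close>; a larger finite \<open>M\<close> gives the supremum of
  such values. Drawing \<open>M\<close> from \<open>compact_below p\<close> keeps
  \<open>above M\<close> non-empty, because it contains \<open>p\<close>.\<close>

definition basic_below :: "'c \<Rightarrow> 'c set" where
  "basic_below p = {b. \<exists>M. finite M \<and> M \<subseteq> compact_below p \<and> is_glb (specialisation L) b (above M)}"

lemma above_subset: "above M \<subseteq> topspace L"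
  by (auto simp: above_def)

lemma mem_above: "M \<subseteq> compact_below p \<Longrightarrow> p \<in> topspace L \<Longrightarrow> p \<in> above M"
  by (auto simp: above_def compact_below_def)

lemma is_glb_aboveD:
  assumes "is_glb (specialisation L) b (above M)"
  shows "b \<in> topspace L" "q \<in> above M \<Longrightarrow> spec_le L b q"
  using assms by (simp_all add: is_glb_specialisation above_subset)

text \<open>Each \<open>c\<close> in \<open>M\<close> is a lower bound of the image of
  \<open>above M\<close> under \<open>l i\<close>, and \<open>l i\<close> preserves the infimum of
  this non-empty set. Hence the infimum is a least element, which is the adjunction
  property.\<close>

lemma glb_mem_above:
  assumes "M \<subseteq> compact_below p" "p \<in> topspace L" "is_glb (specialisation L) b (above M)"
  shows "b \<in> above M"
proof -
  have b: "b \<in> topspace L" using assms(3) by (rule is_glb_aboveD)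
  have "spec_le (X i) c (l i b)" if "(i, c) \<in> M" for i c
  proof -
    from that assms(1) have i: "i \<in> I" and c: "c \<in> topspace (X i)"
      by (auto simp: compact_below_def compact_element_def)
    have "is_glb (specialisation (X i)) (l i b) (l i ` above M)"
      using proj_preserves_nonempty_infs[OF i] assms mem_above above_subset
      unfolding preserves_nonempty_infs_def by (metis carrier_specialisation empty_iff)
    then show ?thesis
      using c that above_subset by (auto simp: is_glb_specialisation image_proj_subset i above_def)
  qed
  with b show ?thesis by (auto simp: above_def)
qed

text \<open>If \<open>b\<close> is below the supremum of \<open>D\<close>, every \<open>c\<close> in
  \<open>M\<close> is below the supremum of a projected directed set, hence below
  \<open>l i d\<close> for some \<open>d\<close> in \<open>D\<close>. As \<open>M\<close> is finite,
  one \<open>e\<close> in \<open>D\<close> dominates all these \<open>d\<close>; then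
  \<open>e\<close> lies in \<open>above M\<close>, so \<open>b \<le> e\<close>.\<close>

lemma compact_element_glb_above:
  assumes "finite M" "M \<subseteq> compact_below p" "p \<in> topspace L" "is_glb (specialisation L) b (above M)"
  shows "compact_element (specialisation L) b"
  unfolding compact_element_def
proof (intro conjI allI impI)
  show "b \<in> carrier (specialisation L)" using assms(4) by (simp add: is_glb_aboveD)
  fix D s
  assume D: "directed_in (specialisation L) D" and s: "is_lub (specialisation L) s D"
    and "spec_le L b s"
  have b: "b \<in> above M" using assms(2-4) by (rule glb_mem_above)
  have DL: "D \<subseteq> topspace L" using D by (simp add: directed_in_def)
  with s have sL: "s \<in> topspace L" by (simp add: is_lub_specialisation)
  have "\<exists>d\<in>D. spec_le (X (fst m)) (snd m) (l (fst m) d)" if "m \<in> M" for m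
  proof -
    obtain i c where m: "m = (i, c)" by fastforce
    with that assms(2) have i: "i \<in> I" and c: "compact_element (specialisation (X i)) c"
      by (auto simp: compact_below_def)
    have "spec_le (X i) c (l i b)" using b that m by (auto simp: above_def)
    moreover have "spec_le (X i) (l i b) (l i s)"
      using \<open>spec_le L b s\<close> b sL i by (simp add: spec_le_limit_iff above_def)
    ultimately have "spec_le (X i) c (l i s)" by (rule spec_le_trans)
    moreover have "is_lub (specialisation (X i)) (l i s) (l i ` D)"
      using proj_preserves_directed_sups[OF i] D s by (simp add: preserves_directed_sups_def)
    ultimately obtain e where "e \<in> l i ` D" "spec_le (X i) c e"
      using c directed_in_proj[OF i D] unfolding compact_element_def by blast
    then show ?thesis using m by auto
  qed
  then obtain d where d: "\<And>m. m \<in> M \<Longrightarrow> d m \<in> D \<and> spec_le (X (fst m)) (snd m) (l (fst m) (d m))"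
    by metis
  have "finite (d ` M)" "d ` M \<subseteq> D" using assms(1) d by auto
  then obtain e where e: "e \<in> D" "\<forall>x\<in>d ` M. spec_le L x e"
    using D by (elim directed_in_finite_bound)
  have "e \<in> above M"
    unfolding above_def
  proof (intro CollectI conjI ballI, safe)
    show eL: "e \<in> topspace L" using e DL by blast
    fix i c assume m: "(i, c) \<in> M"
    then have "spec_le (X i) c (l i (d (i, c)))" using d by fastforce
    moreover have "spec_le (X i) (l i (d (i, c))) (l i e)"
    proof -
      have "i \<in> I" "d (i, c) \<in> topspace L" "spec_le L (d (i, c)) e"
        using m assms(2) d DL e by (auto simp: compact_below_def)
      then show ?thesis using eL by (simp add: spec_le_limit_iff)
    qed
    ultimately show "spec_le (X i) c (l i e)" by (rule spec_le_trans)
  qed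
  then show "\<exists>d\<in>D. spec_le L b d" using e(1) is_glb_aboveD(2)[OF assms(4)] by blast
qed

lemma ex_basic_below:
  assumes "finite M" "M \<subseteq> compact_below p" "p \<in> topspace L"
  obtains b where "b \<in> basic_below p" "b \<in> above M" "is_glb (specialisation L) b (above M)"
proof -
  have "above M \<noteq> {}" using mem_above assms by blast
  then obtain b where "is_glb (specialisation L) b (above M)"
    using ex_glb above_subset by blast
  with assms that show thesis
    using glb_mem_above unfolding basic_below_def by blast
qed

lemma basic_belowD:
  assumes "b \<in> basic_below p" "p \<in> topspace L"
  shows "b \<in> topspace L" "spec_le L b p" "compact_element (specialisation L) b"
  using assms is_glb_aboveD mem_above compact_element_glb_above
  unfolding basic_below_def by blast+

text \<open>\<open>M = {}\<close> contributes the least element of \<open>L\<close>, so the set is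
  non-empty. Two members are bounded by the infimum belonging to the union of their constraint
  sets.\<close>

lemma directed_in_basic_below:
  assumes p: "p \<in> topspace L"
  shows "directed_in (specialisation L) (basic_below p)"
  unfolding directed_in_def
proof (intro conjI ballI)
  show "basic_below p \<subseteq> carrier (specialisation L)" using basic_belowD(1) p by auto
  show "basic_below p \<noteq> {}" using ex_basic_below[of "{}" p] p by blast
  fix b b' assume "b \<in> basic_below p" "b' \<in> basic_below p"
  then obtain M M' where M: "finite M" "M \<subseteq> compact_below p" "is_glb (specialisation L) b (above M)"
    and M': "finite M'" "M' \<subseteq> compact_below p" "is_glb (specialisation L) b' (above M')"
    unfolding basic_below_def by blast
  have "finite (M \<union> M')" "M \<union> M' \<subseteq> compact_below p" using M M' by auto
  then obtain a where a: "a \<in> basic_below p" "a \<in> above (M \<union> M')"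
    using p by (elim ex_basic_below)
  then have "a \<in> above M" "a \<in> above M'" by (auto simp: above_def)
  with a(1) M(3) M'(3) show "\<exists>z\<in>basic_below p. spec_le L b z \<and> spec_le L b' z"
    using is_glb_aboveD(2) by blast
qed

text \<open>An upper bound \<open>u\<close> dominates the elements coming from singletons
  \<open>{(i, c)}\<close>, so \<open>c \<le> l i u\<close> for every compact
  \<open>c \<le> l i p\<close>. Algebraicity of \<open>X i\<close> then gives
  \<open>l i p \<le> l i u\<close>.\<close>

lemma is_lub_basic_below:
  assumes p: "p \<in> topspace L"
  shows "is_lub (specialisation L) p (basic_below p)"
proof -
  have "spec_le L p u" if u: "u \<in> topspace L" "\<forall>b\<in>basic_below p. spec_le L b u" for u
  proof -
    have "spec_le (X i) (l i p) (l i u)" if i: "i \<in> I" for i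
    proof -
      let ?C = "{c. compact_element (specialisation (X i)) c \<and> spec_le (X i) c (l i p)}"
      have "is_lub (specialisation (X i)) (l i p) ?C"
        using domain[OF i] proj[OF i p] by (simp add: algebraic_domain_def)
      moreover have "?C \<subseteq> topspace (X i)" by (auto simp: compact_element_def)
      moreover have "spec_le (X i) c (l i u)" if "c \<in> ?C" for c
      proof -
        have "{(i, c)} \<subseteq> compact_below p" using that i by (auto simp: compact_below_def)
        then obtain b where b: "b \<in> basic_below p" "b \<in> above {(i, c)}"
          using ex_basic_below[of "{(i, c)}" p] p by blast
        then have "spec_le L b u" "b \<in> topspace L" using u by (auto simp: above_def)
        then have "spec_le (X i) (l i b) (l i u)" using u(1) i by (simp add: spec_le_limit_iff)
        moreover have "spec_le (X i) c (l i b)" using b by (simp add: above_def)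
        ultimately show ?thesis by (metis spec_le_trans)
      qed
      ultimately show ?thesis
        using proj[OF i u(1)] by (simp add: is_lub_specialisation)
    qed
    then show ?thesis using p u(1) by (simp add: spec_le_limit_iff)
  qed
  moreover have "basic_below p \<subseteq> topspace L" using basic_belowD(1) p by blast
  ultimately show ?thesis
    using p basic_belowD(2)[OF _ p] by (simp add: is_lub_specialisation)
qed

text \<open>Since \<open>p\<close> is the directed supremum of \<open>basic_below p\<close>, each
  compact element below \<open>p\<close> lies below a basic one. Directedness and the supremum pass
  from this cofinal subset to the set of all compact elements below \<open>p\<close>.\<close>

lemma algebraic_domain_limit: "algebraic_domain (specialisation L)"
  unfolding algebraic_domain_def
proof (intro conjI dcpo_limit ballI)
  fix p assume "p \<in> carrier (specialisation L)"
  then have p: "p \<in> topspace L" by simp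
  let ?C = "{c. compact_element (specialisation L) c \<and> spec_le L c p}"
  have C: "?C \<subseteq> topspace L" by (auto simp: compact_element_def)
  have sub: "basic_below p \<subseteq> ?C" using basic_belowD p by blast
  have cofinal: "\<exists>b\<in>basic_below p. spec_le L c b" if "c \<in> ?C" for c
    using that directed_in_basic_below[OF p] is_lub_basic_below[OF p]
    unfolding compact_element_def by blast
  show "directed_in (specialisation L) ?C"
    unfolding directed_in_def
  proof (intro conjI ballI)
    show "?C \<subseteq> carrier (specialisation L)" using C by simp
    show "?C \<noteq> {}" using sub directed_in_basic_below[OF p] unfolding directed_in_def by blast
    fix c c' assume "c \<in> ?C" "c' \<in> ?C"
    then obtain b b' where b: "b \<in> basic_below p" "spec_le L c b" "b' \<in> basic_below p" "spec_le L c' b'"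
      using cofinal by meson
    then obtain z where z: "z \<in> basic_below p" "spec_le L b z" "spec_le L b' z"
      using directed_in_basic_below[OF p] unfolding directed_in_def by blast
    then have "spec_le L c z \<and> spec_le L c' z" using b by (auto intro: spec_le_trans)
    with z(1) sub show "\<exists>z\<in>?C. spec_le L c z \<and> spec_le L c' z" by blast
  qed
  have "basic_below p \<subseteq> topspace L" using sub C by blast
  then have "\<forall>u\<in>topspace L. (\<forall>b\<in>basic_below p. spec_le L b u) \<longrightarrow> spec_le L p u"
    using is_lub_basic_below[OF p] by (simp add: is_lub_specialisation)
  then show "is_lub (specialisation L) p ?C"
    using p C sub by (auto simp: is_lub_specialisation)
qed

lemma openin_above:
  assumes "finite M" "M \<subseteq> compact_below p"
  shows "openin L (above M)"
  using assms
proof (induction M)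
  case empty
  then show ?case by (simp add: above_def)
next
  case (insert m M)
  obtain i c where m: "m = (i, c)" by fastforce
  with insert.prems have i: "i \<in> I" and c: "compact_element (specialisation (X i)) c"
    by (auto simp: compact_below_def)
  have "openin (X i) {x \<in> topspace (X i). spec_le (X i) c x}"
    using domain[OF i] c by (intro openin_above_compact_element) auto
  then have "openin L {q \<in> topspace L. l i q \<in> {x \<in> topspace (X i). spec_le (X i) c x}}"
    by (rule openin_continuous_map_preimage[OF continuous_proj[OF i]])
  moreover have "above (insert m M) = above M \<inter> {q \<in> topspace L. l i q \<in> {x \<in> topspace (X i). spec_le (X i) c x}}"
    using m proj[OF i] by (auto simp: above_def)
  ultimately show ?case using insert by auto
qed

text \<open>An open box around a directed supremum has finitely many proper sides, each met by the
  projected set, so an upper bound of finitely many members lies in the box. Conversely, a Scott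
  open \<open>U\<close> around \<open>p\<close> contains some \<open>b\<close> in
  \<open>basic_below p\<close>; the corresponding \<open>above M\<close> is an open neighbourhood of
  \<open>p\<close> consisting of elements above \<open>b\<close>, hence contained in
  \<open>U\<close>.\<close>

lemma scott_topology_limit: "L = scott_topology (specialisation L)"
proof -
  have scott: "scott_open (specialisation L) U" if U: "openin L U" for U
    unfolding scott_open_def
  proof (intro conjI ballI allI impI)
    show "U \<subseteq> carrier (specialisation L)" using U openin_subset by auto
    show "y \<in> U" if "x \<in> U" "spec_le L x y" for x y
      using that U by (simp add: spec_le_iff)
    fix D s
    assume D: "directed_in (specialisation L) D" and s: "is_lub (specialisation L) s D" and sU: "s \<in> U"
    from U sU obtain V where V: "finite {i \<in> I. V i \<noteq> topspace (X i)}"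
      "\<And>i. i \<in> I \<Longrightarrow> openin (X i) (V i)" "\<And>i. i \<in> I \<Longrightarrow> l i s \<in> V i"
      and VU: "\<And>q. q \<in> topspace L \<Longrightarrow> (\<And>i. i \<in> I \<Longrightarrow> l i q \<in> V i) \<Longrightarrow> q \<in> U"
      by (rule openinE) blast
    let ?J = "{i \<in> I. V i \<noteq> topspace (X i)}"
    have "\<exists>d\<in>D. l i d \<in> V i" if i: "i \<in> I" for i
    proof -
      have "scott_open (specialisation (X i)) (V i)"
        using V(2)[OF i] domain[OF i] by (metis in_cat.simps(3) openin_scott_topology)
      moreover have "is_lub (specialisation (X i)) (l i s) (l i ` D)"
        using proj_preserves_directed_sups[OF i] D s by (simp add: preserves_directed_sups_def)
      ultimately have "l i ` D \<inter> V i \<noteq> {}"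
        using directed_in_proj[OF i D] V(3)[OF i] unfolding scott_open_def by blast
      then show ?thesis by blast
    qed
    then obtain d where d: "\<And>i. i \<in> I \<Longrightarrow> d i \<in> D \<and> l i (d i) \<in> V i" by metis
    have "finite (d ` ?J)" "d ` ?J \<subseteq> D" using V(1) d by auto
    then obtain e where e: "e \<in> D" "\<forall>x\<in>d ` ?J. spec_le L x e"
      using D by (elim directed_in_finite_bound)
    have DL: "D \<subseteq> topspace L" using D by (simp add: directed_in_def)
    have "e \<in> U"
    proof (rule VU)
      show eL: "e \<in> topspace L" using e DL by blast
      fix i assume i: "i \<in> I"
      show "l i e \<in> V i"
      proof (cases "V i = topspace (X i)")
        case True
        then show ?thesis using proj[OF i eL] by simp
      next
        case False
        then have "spec_le L (d i) e" using e i by blast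
        then have "spec_le (X i) (l i (d i)) (l i e)"
          using d[OF i] DL eL i by (subst (asm) spec_le_limit_iff) auto
        then show ?thesis using d[OF i] V(2)[OF i] by (simp add: spec_le_iff)
      qed
    qed
    with e(1) show "D \<inter> U \<noteq> {}" by blast
  qed
  have "openin L U" if U: "scott_open (specialisation L) U" for U
  proof (subst openin_subopen, rule ballI)
    fix p assume pU: "p \<in> U"
    then have p: "p \<in> topspace L" using U by (auto simp: scott_open_def)
    then have "basic_below p \<inter> U \<noteq> {}"
      using U pU directed_in_basic_below is_lub_basic_below unfolding scott_open_def by blast
    then obtain b M where b: "b \<in> U" and M: "finite M" "M \<subseteq> compact_below p"
      "is_glb (specialisation L) b (above M)"
      unfolding basic_below_def by blast
    have "above M \<subseteq> U"
      using U b is_glb_aboveD(2)[OF M(3)] above_subset[of M]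
      unfolding scott_open_def carrier_specialisation by blast
    then show "\<exists>T. openin L T \<and> p \<in> T \<and> T \<subseteq> U"
      using openin_above[OF M(1,2)] mem_above[OF M(2) p] by blast
  qed
  with scott show ?thesis
    by (subst topology_eq) auto
qed

lemma in_ADom_limit: "in_cat ADom L"
  using algebraic_domain_limit bounded_complete_if_glb[OF ex_glb] scott_topology_limit by simp

lemma is_ADom_arrow_proj: "i \<in> I \<Longrightarrow> is_arrow ADom L (X i) (l i)"
  using proj_preserves_directed_sups proj_preserves_nonempty_infs by simp

end

section \<open>Maps into the limit induced by cones of domain arrows\<close>

context inserter
begin

text \<open>Suprema in \<open>L\<close> may be verified coordinatewise, and there \<open>t\<close>
  becomes \<open>a i\<close>, which preserves them.\<close>

lemma preserves_directed_sups_mediating: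
  assumes t: "t \<in> topspace A \<rightarrow> topspace L"
    and a: "\<And>i. i \<in> I \<Longrightarrow> preserves_directed_sups (specialisation A) (specialisation (X i)) (a i)"
    and eq: "\<And>i p. i \<in> I \<Longrightarrow> p \<in> topspace A \<Longrightarrow> a i p = l i (t p)"
  shows "preserves_directed_sups (specialisation A) (specialisation L) t"
  unfolding preserves_directed_sups_def
proof (intro conjI allI impI)
  fix D s assume D: "directed_in (specialisation A) D" and s: "is_lub (specialisation A) s D"
  from D have DA: "D \<subseteq> topspace A" by (simp add: directed_in_def)
  with s have sA: "s \<in> topspace A" by (simp add: is_lub_specialisation)
  show "is_lub (specialisation L) (t s) (t ` D)"
  proof (rule is_lub_pointwise)
    show "is_lub (specialisation (X i)) (l i (t s)) (l i ` t ` D)" if "i \<in> I" for i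
    proof -
      have "is_lub (specialisation (X i)) (a i s) (a i ` D)"
        using a[OF that] D s by (simp add: preserves_directed_sups_def)
      moreover have "a i ` D = l i ` t ` D"
        using eq[OF that] DA by (force simp: image_image)
      ultimately show ?thesis using eq[OF that sA] by simp
    qed
  qed (use t DA sA in auto)
qed (use t in simp)

text \<open>Stated for one set \<open>S\<close> at a time, so that it serves both non-empty and
  arbitrary infima.\<close>

lemma is_glb_mediating:
  assumes t: "t \<in> topspace A \<rightarrow> topspace L"
    and a: "\<And>i. i \<in> I \<Longrightarrow> is_glb (specialisation (X i)) (a i s) (a i ` S)"
    and eq: "\<And>i p. i \<in> I \<Longrightarrow> p \<in> topspace A \<Longrightarrow> a i p = l i (t p)"
    and S: "S \<subseteq> topspace A" "s \<in> topspace A"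
  shows "is_glb (specialisation L) (t s) (t ` S)"
proof (rule is_glb_pointwise)
  show "is_glb (specialisation (X i)) (l i (t s)) (l i ` t ` S)" if "i \<in> I" for i
  proof -
    have "a i ` S = l i ` t ` S"
      using eq[OF that] S(1) by (force simp: image_image)
    then show ?thesis using a[OF that] eq[OF that S(2)] by simp
  qed
qed (use t S in auto)

lemma is_ADom_arrow_mediating:
  assumes t: "t \<in> topspace A \<rightarrow> topspace L"
    and a: "\<And>i. i \<in> I \<Longrightarrow> is_arrow ADom A (X i) (a i)"
    and eq: "\<And>i p. i \<in> I \<Longrightarrow> p \<in> topspace A \<Longrightarrow> a i p = l i (t p)"
  shows "is_arrow ADom A L t"
proof -
  have "is_glb (specialisation L) (t s) (t ` S)"
    if S: "S \<subseteq> topspace A" "S \<noteq> {}" and s: "is_glb (specialisation A) s S" for S s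
  proof (rule is_glb_mediating[OF t _ eq S(1)])
    show "is_glb (specialisation (X i)) (a i s) (a i ` S)" if "i \<in> I" for i
      using a[OF that] S s by (simp add: preserves_nonempty_infs_def)
    show "s \<in> topspace A" using s S(1) by (simp add: is_glb_specialisation)
  qed
  then show ?thesis
    using preserves_directed_sups_mediating[where a = a, OF t _ eq] a t
    by (simp add: preserves_nonempty_infs_def)
qed

lemma is_ALat_arrow_mediating:
  assumes t: "t \<in> topspace A \<rightarrow> topspace L"
    and a: "\<And>i. i \<in> I \<Longrightarrow> is_arrow ALat A (X i) (a i)"
    and eq: "\<And>i p. i \<in> I \<Longrightarrow> p \<in> topspace A \<Longrightarrow> a i p = l i (t p)"
  shows "is_arrow ALat A L t"
proof -
  have "is_glb (specialisation L) (t s) (t ` S)"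
    if S: "S \<subseteq> topspace A" and s: "is_glb (specialisation A) s S" for S s
  proof (rule is_glb_mediating[OF t _ eq S(1)])
    show "is_glb (specialisation (X i)) (a i s) (a i ` S)" if "i \<in> I" for i
      using a[OF that] S s by (simp add: preserves_infs_def)
    show "s \<in> topspace A" using s S(1) by (simp add: is_glb_specialisation)
  qed
  then show ?thesis
    using preserves_directed_sups_mediating[where a = a, OF t _ eq] a t
    by (simp add: preserves_infs_def)
qed

end

section \<open>Algebraic lattices\<close>

lemma bounded_complete_if_complete_lattice:
  assumes "complete_lattice P"
  shows "bounded_complete P"
  using complete_lattice.sup_exists[OF assms] by (simp add: bounded_complete_def)

lemma in_ADom_if_in_ALat: "in_cat ALat X \<Longrightarrow> in_cat ADom X"
  by (simp add: algebraic_lattice_def bounded_complete_if_complete_lattice)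

lemma is_ADom_arrow_if_is_ALat_arrow: "is_arrow ALat X Y f \<Longrightarrow> is_arrow ADom X Y f"
  by (simp add: preserves_infs_def preserves_nonempty_infs_def)

locale lattice_inserter = inserter +
  assumes lattice: "i \<in> I \<Longrightarrow> in_cat ALat (X i)"
    and lattice_arrow: "(i, j, k, f, g) \<in> R \<Longrightarrow>
      is_arrow ALat (X i) (X k) f \<and> is_arrow ALat (X j) (X k) g"

text \<open>Algebraicity, the Scott topology and non-empty infima are inherited from domains; only
  the infimum of the empty set remains for lattices.\<close>

sublocale lattice_inserter \<subseteq> domain_inserter
  by unfold_locales (use lattice lattice_arrow in_ADom_if_in_ALat is_ADom_arrow_if_is_ALat_arrow in blast)+

context lattice_inserter
begin

text \<open>The infimum of \<open>{}\<close> is the greatest element. The family of greatest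
  elements is compatible because lattice arrows preserve the empty infimum too.\<close>

lemma ex_pointwise_top:
  "\<exists>p\<in>topspace L. \<forall>i\<in>I. is_glb (specialisation (X i)) (l i p) (l i ` {})"
proof (rule ex_pointwise_glb)
  show "\<exists>s. is_glb (specialisation (X i)) s (l i ` {})" if "i \<in> I" for i
    using lattice[OF that] complete_lattice.inf_exists[of "specialisation (X i)" "{}"]
    by (simp add: algebraic_lattice_def)
  show "is_glb (specialisation (X k)) (g s) (g ` l j ` {})"
    if "(i, j, k, f, g) \<in> R" "is_glb (specialisation (X j)) s (l j ` {})" for i j k f g s
    using lattice_arrow[OF that(1)] that(2) unfolding is_arrow.simps preserves_infs_def
    by (metis empty_subsetI image_empty)
qed (simp, (fact arrow_mono)+)

lemma ex_inf:
  assumes "S \<subseteq> topspace L"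
  shows "\<exists>p\<in>topspace L. \<forall>i\<in>I. is_glb (specialisation (X i)) (l i p) (l i ` S)"
  using ex_nonempty_glb[OF assms] ex_pointwise_top by (cases "S = {}") auto

lemma in_ALat_limit: "in_cat ALat L"
proof -
  interpret partial_order "specialisation L" by (rule partial_order_limit)
  have glb: "\<exists>p. is_glb (specialisation L) p S" if "S \<subseteq> topspace L" for S
    using ex_inf[OF that] is_glb_pointwise[OF that] by blast
  have "complete_lattice (specialisation L)"
  proof (rule complete_lattice_criterion1)
    show "\<exists>g. greatest (specialisation L) g (carrier (specialisation L))"
      using glb[of "{}"] by simp
  qed (use glb in simp)
  then show ?thesis
    using algebraic_domain_limit scott_topology_limit by (simp add: algebraic_lattice_def)
qed

lemma is_ALat_arrow_proj:
  assumes i: "i \<in> I"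
  shows "is_arrow ALat L (X i) (l i)"
proof -
  have "is_glb (specialisation (X i)) (l i s) (l i ` S)"
    if S: "S \<subseteq> topspace L" and s: "is_glb (specialisation L) s S" for S s
  proof -
    from ex_inf[OF S] obtain p where p: "p \<in> topspace L"
      "\<forall>i\<in>I. is_glb (specialisation (X i)) (l i p) (l i ` S)" by blast
    then have "is_glb (specialisation L) p S"
      using is_glb_pointwise[OF S] by blast
    then have "p = s"
      using s partial_order.greatest_unique[OF partial_order_limit] by metis
    then show ?thesis using p i by blast
  qed
  then show ?thesis
    using proj_preserves_directed_sups[OF i] proj[OF i] by (simp add: preserves_infs_def)
qed

end

section \<open>Spectral spaces\<close>

abbreviation point_closure :: "'a topology \<Rightarrow> 'a \<Rightarrow> 'a set" where
  "point_closure X x \<equiv> Abstract_Topology.closure_of X {x}"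

text \<open>A \<open>T\<^sub>0\<close> space is spectral iff it has a patch in the following sense. For a spectral space one
  takes the topology \<open>patch\<close> generated by the compact opens and their complements.\<close>

definition is_patch :: "'a topology \<Rightarrow> 'a topology \<Rightarrow> bool" where
  "is_patch P X \<longleftrightarrow> topspace P = topspace X \<and> compact_space P \<and>
     (\<forall>U. openin X U \<longrightarrow> openin P U) \<and>
     (\<forall>U p. openin X U \<longrightarrow> p \<in> U \<longrightarrow> (\<exists>N. openin X N \<and> closedin P N \<and> p \<in> N \<and> N \<subseteq> U))"

lemma is_patch_nbhd:
  assumes "is_patch P X" "openin X U" "p \<in> U"
  obtains N where "openin X N" "closedin P N" "p \<in> N" "N \<subseteq> U"
  using assms unfolding is_patch_def by meson

lemma is_patch_compactin:
  assumes "is_patch P X" "compactin P S"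
  shows "compactin X S"
  using compactin_contractive[of P S X] assms by (simp add: is_patch_def)

lemma is_patch_compactin_if_closedin:
  assumes "is_patch P X" "closedin P S"
  shows "compactin X S"
proof -
  have "compact_space P" using assms(1) by (simp add: is_patch_def)
  then have "compactin P S" using assms(2) by (rule closedin_compact_space)
  then show ?thesis by (rule is_patch_compactin[OF assms(1)])
qed

text \<open>Let \<open>q\<close> lie outside the upper set \<open>K\<close>. No \<open>p\<close> in
  \<open>K\<close> is below \<open>q\<close>, so some open, patch-closed \<open>N\<close> contains
  \<open>p\<close> but not \<open>q\<close>. Finitely many such \<open>N\<close> cover
  \<open>K\<close>, and the complement of their union is a patch neighbourhood of \<open>q\<close>
  missing \<open>K\<close>.\<close>

lemma is_patch_closedin_if_saturated:
  assumes P: "is_patch P X" and K: "compactin X K" "saturated_in X K"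
  shows "closedin P K"
proof -
  have top: "topspace P = topspace X" using P by (simp add: is_patch_def)
  have KX: "K \<subseteq> topspace X" using K(1) by (rule compactin_subset_topspace)
  have "openin P (topspace P - K)"
  proof (subst openin_subopen, rule ballI)
    fix q assume q: "q \<in> topspace P - K"
    let ?N = "{N. openin X N \<and> closedin P N \<and> q \<notin> N}"
    have "\<exists>N\<in>?N. p \<in> N" if p: "p \<in> K" for p
    proof -
      have "\<not> spec_le X p q" using K(2) p q top unfolding saturated_in_def by blast
      then obtain U where U: "openin X U" "p \<in> U" "q \<notin> U" by (auto simp: spec_le_iff)
      show ?thesis by (rule is_patch_nbhd[OF P U(1,2)]) (use U(3) in blast)
    qed
    then have "K \<subseteq> \<Union>?N" by blast
    moreover have "\<forall>N\<in>?N. openin X N" by blast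
    ultimately obtain \<F> where F: "finite \<F>" "\<F> \<subseteq> ?N" "K \<subseteq> \<Union>\<F>"
      using K(1) unfolding compactin_def by meson
    have "closedin P (\<Union>\<F>)" using F by (intro closedin_Union) auto
    then have "openin P (topspace P - \<Union>\<F>)" by blast
    moreover have "q \<in> topspace P - \<Union>\<F>" "topspace P - \<Union>\<F> \<subseteq> topspace P - K"
      using F q by auto
    ultimately show "\<exists>T. openin P T \<and> q \<in> T \<and> T \<subseteq> topspace P - K" by blast
  qed
  then show ?thesis using KX top by (simp add: closedin_def)
qed

text \<open>Compact saturated sets are patch-closed, patch-continuity pulls them back to
  patch-closed sets, and these are compact. Spectrality is thus reduced to two continuity
  conditions, which can be tested on projections.\<close>

lemma spectral_map_if_continuous_map_patch:
  assumes "is_patch P X" "is_patch Q Y" "continuous_map X Y f" "continuous_map P Q f"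
  shows "spectral_map X Y f"
  unfolding spectral_map_def
proof (intro conjI allI impI)
  fix K assume "compactin Y K" "saturated_in Y K"
  then have "closedin Q K" by (rule is_patch_closedin_if_saturated[OF assms(2)])
  then have "closedin P {x \<in> topspace P. f x \<in> K}"
    by (rule closedin_continuous_map_preimage[OF assms(4)])
  then have "compactin X {x \<in> topspace P. f x \<in> K}"
    by (rule is_patch_compactin_if_closedin[OF assms(1)])
  then show "compactin X {x \<in> topspace X. f x \<in> K}"
    using assms(1) by (simp add: is_patch_def)
qed (rule assms(3))

text \<open>By irreducibility the open, patch-closed sets meeting \<open>C\<close> have the finite
  intersection property inside \<open>C\<close>, so patch compactness yields a point
  \<open>p\<close> of \<open>C\<close> in all of them. Every open set meeting \<open>C\<close>
  contains such a set, hence contains \<open>p\<close>; therefore \<open>p\<close> is generic, and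
  it is unique by T0.\<close>

lemma sober_space_if_is_patch:
  assumes P: "is_patch P X" and t0: "t0_space X"
  shows "sober_space X"
  unfolding sober_space_def
proof (intro allI impI)
  fix C assume C: "irreducible_closed_in X C"
  then have clC: "closedin X C" "C \<noteq> {}" by (auto simp: irreducible_closed_in_def)
  have top: "topspace P = topspace X" using P by (simp add: is_patch_def)
  have finer: "openin X U \<Longrightarrow> openin P U" for U using P by (simp add: is_patch_def)
  have CP: "closedin P C"
    using clC finer top by (simp add: closedin_def)
  have meet: "C \<inter> (M \<inter> N) \<noteq> {}"
    if "openin X M" "openin X N" "C \<inter> M \<noteq> {}" "C \<inter> N \<noteq> {}" for M N
  proof
    assume "C \<inter> (M \<inter> N) = {}"
    then have "C = (C - M) \<union> (C - N)" by blast
    moreover have "closedin X (C - M)" "closedin X (C - N)" using clC that by (auto intro: closedin_diff)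
    ultimately have "C = C - M \<or> C = C - N"
      using C unfolding irreducible_closed_in_def by blast
    with that show False by blast
  qed
  let ?N = "{N. openin X N \<and> closedin P N \<and> C \<inter> N \<noteq> {}}"
  \<comment> \<open>Stronger than non-emptiness of the intersection, so that the induction can
    continue: \<open>meet\<close> shows that \<open>M \<inter> N\<close> is again a member of
    \<open>?N\<close>.\<close>
  have fin: "\<exists>N\<in>?N. C \<inter> N \<subseteq> \<Inter>\<F>" if "finite \<F>" "\<F> \<subseteq> (\<lambda>N. C \<inter> N) ` ?N" for \<F>
    using that
  proof (induction \<F>)
    case empty
    have "closedin P (topspace X)" using closedin_topspace[of P] top by simp
    moreover have "C \<inter> topspace X = C" using closedin_subset[OF clC(1)] by blast
    ultimately have "topspace X \<in> ?N" using clC(2) by simp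
    then show ?case by blast
  next
    case (insert A \<F>)
    then obtain N where N: "N \<in> ?N" "C \<inter> N \<subseteq> \<Inter>\<F>" by auto
    from insert.prems obtain M where M: "M \<in> ?N" "A = C \<inter> M" by auto
    have "M \<inter> N \<in> ?N" using M(1) N(1) meet[of M N] by auto
    moreover have "C \<inter> (M \<inter> N) \<subseteq> \<Inter>(insert A \<F>)" using M N by auto
    ultimately show ?case by blast
  qed
  have "\<Inter>((\<lambda>N. C \<inter> N) ` ?N) \<noteq> {}"
  proof -
    have "\<forall>A\<in>(\<lambda>N. C \<inter> N) ` ?N. closedin P A" using CP by auto
    moreover have "\<forall>\<F>. finite \<F> \<and> \<F> \<subseteq> (\<lambda>N. C \<inter> N) ` ?N \<longrightarrow> \<Inter>\<F> \<noteq> {}"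
      using fin by fast
    ultimately show ?thesis
      using P unfolding is_patch_def compact_space_fip by blast
  qed
  then obtain p where "p \<in> \<Inter>((\<lambda>N. C \<inter> N) ` ?N)" by blast
  then have p: "\<forall>N\<in>?N. p \<in> C \<inter> N" by blast
  \<comment> \<open>Membership in all the sets \<open>C \<inter> N\<close> puts \<open>p\<close>
    into \<open>C\<close> only if there is at least one such set.\<close>
  moreover have "?N \<noteq> {}" using fin[of "{}"] by auto
  ultimately have pC: "p \<in> C" by blast
  have cl: "point_closure X p = C"
  proof
    show "point_closure X p \<subseteq> C" using pC clC by (simp add: closure_of_minimal)
    show "C \<subseteq> point_closure X p"
    proof
      fix c assume c: "c \<in> C"
      have "p \<in> T" if T: "c \<in> T" "openin X T" for T
      proof -
        obtain N where "openin X N" "closedin P N" "c \<in> N" "N \<subseteq> T"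
          using is_patch_nbhd[OF P T(2,1)] .
        then show ?thesis using p c by blast
      qed
      then show "c \<in> point_closure X p"
        using c closedin_subset[OF clC(1)] by (auto simp: in_closure_of)
    qed
  qed
  have pX: "p \<in> topspace X" using pC closedin_subset[OF clC(1)] by blast
  show "\<exists>!x. x \<in> topspace X \<and> point_closure X x = C"
  proof (rule ex1I[of _ p])
    fix q assume q: "q \<in> topspace X \<and> point_closure X q = C"
    then have "spec_le X p q" "spec_le X q p"
      using cl pX in_closure_of[of p X "{q}"] in_closure_of[of q X "{p}"] in_closure_of[of q X "{q}"] pC
      unfolding spec_le_iff by auto
    then show "q = p" using spec_le_antisym[OF t0] q pX by metis
  qed (use cl pX in blast)
qed

text \<open>Patch-closed sets are compact, so the open ones among them form a base of compact opens.
  Compact saturated sets are patch-closed, and so are their intersections, including the empty one,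
  which gives compactness of \<open>X\<close> itself.\<close>

lemma spectral_space_if_is_patch:
  assumes P: "is_patch P X" and t0: "t0_space X"
  shows "spectral_space X"
proof -
  have base: "\<exists>N. openin X N \<and> compactin X N \<and> p \<in> N \<and> N \<subseteq> U" if U: "openin X U" "p \<in> U" for U p
  proof -
    obtain N where N: "openin X N" "closedin P N" "p \<in> N" "N \<subseteq> U"
      using is_patch_nbhd[OF P U] .
    from N(2) have "compactin X N" by (rule is_patch_compactin_if_closedin[OF P])
    with N show ?thesis by blast
  qed
  have "neighbourhood_base_of (compactin X) X"
    unfolding neighbourhood_base_of_def neighbourhood_base_at_def
  proof (intro ballI allI impI, elim conjE)
    fix p U assume "openin X U" "p \<in> U"
    then obtain N where "openin X N" "compactin X N" "p \<in> N" "N \<subseteq> U" using base by meson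
    then show "\<exists>N V. openin X N \<and> compactin X V \<and> p \<in> N \<and> N \<subseteq> V \<and> V \<subseteq> U" by blast
  qed
  moreover have "compactin X (topspace X \<inter> \<Inter>\<K>)"
    if K: "\<forall>K\<in>\<K>. compactin X K \<and> saturated_in X K" for \<K>
  proof (rule is_patch_compactin_if_closedin[OF P])
    have top: "topspace P = topspace X" using P by (simp add: is_patch_def)
    have "closedin P (\<Inter>(insert (topspace P) \<K>))"
      using K is_patch_closedin_if_saturated[OF P] by (intro closedin_Inter) auto
    then show "closedin P (topspace X \<inter> \<Inter>\<K>)" using top by simp
  qed
  moreover have "(arbitrary union_of (\<lambda>U. openin X U \<and> compactin X U)) U \<longleftrightarrow> openin X U" for U
  proof
    assume "(arbitrary union_of (\<lambda>U. openin X U \<and> compactin X U)) U"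
    then show "openin X U" unfolding union_of_def by auto
  next
    assume U: "openin X U"
    let ?B = "{N. openin X N \<and> compactin X N \<and> N \<subseteq> U}"
    have "\<Union>?B = U" using base[OF U] by auto
    moreover have "?B \<subseteq> Collect (\<lambda>U. openin X U \<and> compactin X U)" by blast
    ultimately show "(arbitrary union_of (\<lambda>U. openin X U \<and> compactin X U)) U"
      unfolding union_of_def arbitrary_def by blast
  qed
  ultimately show ?thesis
    using sober_space_if_is_patch[OF P t0]
    unfolding spectral_space_def stably_compact_space_def by blast
qed

text \<open>Point closures are irreducible, and points with the same open neighbourhoods have the
  same closure; uniqueness of generic points identifies them.\<close>

lemma t0_space_if_sober_space:
  assumes "sober_space X"
  shows "t0_space X"
proof -
  have "x = y" if x: "x \<in> topspace X" and y: "y \<in> topspace X"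
    and eq: "\<And>U. openin X U \<Longrightarrow> x \<in> U \<longleftrightarrow> y \<in> U" for x y
  proof -
    have "irreducible_closed_in X (point_closure X x)"
      unfolding irreducible_closed_in_def
    proof (intro conjI allI impI)
      have xc: "x \<in> point_closure X x" using x by (simp add: in_closure_of)
      then show "point_closure X x \<noteq> {}" by blast
      fix A B assume AB: "closedin X A" "closedin X B" "point_closure X x = A \<union> B"
      with xc have "x \<in> A \<or> x \<in> B" by blast
      then have "point_closure X x \<subseteq> A \<or> point_closure X x \<subseteq> B"
        using AB closure_of_minimal by (metis empty_subsetI insert_subset)
      with AB show "point_closure X x = A \<or> point_closure X x = B" by blast
    qed simp
    moreover have "point_closure X y = point_closure X x"
      using eq by (auto simp: in_closure_of)
    ultimately show ?thesis using assms x y unfolding sober_space_def by blast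
  qed
  then show ?thesis unfolding t0_space_def by blast
qed

section \<open>The patch topology of a spectral space\<close>

definition compact_open :: "'a topology \<Rightarrow> 'a set \<Rightarrow> bool" where
  "compact_open X K \<longleftrightarrow> openin X K \<and> compactin X K"

lemma spectral_space_base:
  assumes "spectral_space X" "openin X U" "x \<in> U"
  obtains K where "compact_open X K" "x \<in> K" "K \<subseteq> U"
proof -
  have "(arbitrary union_of (\<lambda>U. openin X U \<and> compactin X U)) U"
    using assms(1,2) by (simp add: spectral_space_def)
  then obtain \<U> where "\<U> \<subseteq> Collect (\<lambda>U. openin X U \<and> compactin X U)" "\<Union>\<U> = U"
    unfolding union_of_def by blast
  with assms(3) that show thesis unfolding compact_open_def by blast
qed

lemma saturated_in_openin: "openin X U \<Longrightarrow> saturated_in X U"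
  unfolding saturated_in_def spec_le_iff using openin_subset by blast

lemma compact_open_Inter:
  assumes "spectral_space X" "finite \<K>" "\<forall>K\<in>\<K>. compact_open X K"
  shows "compact_open X (topspace X \<inter> \<Inter>\<K>)"
  unfolding compact_open_def
proof
  show "openin X (topspace X \<inter> \<Inter>\<K>)"
    using assms(2,3) by (induction \<K>) (auto simp: compact_open_def Int_left_commute)
  show "compactin X (topspace X \<inter> \<Inter>\<K>)"
    using assms saturated_in_openin unfolding spectral_space_def stably_compact_space_def compact_open_def
    by blast
qed

text \<open>By Zorn, the \<open>\<U>\<close> below is contained in a maximal open set covering no finite intersection of
  members of \<open>\<K>\<close>; its complement is irreducible and its generic point is left uncovered.\<close>

lemma spectral_space_finite_cover:
  assumes X: "spectral_space X"
    and U: "\<And>U. U \<in> \<U> \<Longrightarrow> openin X U" and K: "\<And>K. K \<in> \<K> \<Longrightarrow> compact_open X K"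
    and cover: "topspace X \<inter> \<Inter>\<K> \<subseteq> \<Union>\<U>"
  shows "\<exists>\<U>' \<K>'. finite \<U>' \<and> \<U>' \<subseteq> \<U> \<and> finite \<K>' \<and> \<K>' \<subseteq> \<K> \<and>
    topspace X \<inter> \<Inter>\<K>' \<subseteq> \<Union>\<U>'"
proof (rule ccontr)
  assume contra: "\<not> ?thesis"
  define A where "A = {V. openin X V \<and> \<Union>\<U> \<subseteq> V \<and>
    (\<forall>\<G>. finite \<G> \<longrightarrow> \<G> \<subseteq> \<K> \<longrightarrow> \<not> topspace X \<inter> \<Inter>\<G> \<subseteq> V)}"
  have memA: "V \<in> A \<longleftrightarrow> openin X V \<and> \<Union>\<U> \<subseteq> V \<and>
    (\<forall>\<G>. finite \<G> \<longrightarrow> \<G> \<subseteq> \<K> \<longrightarrow> \<not> topspace X \<inter> \<Inter>\<G> \<subseteq> V)" for V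
    by (simp add: A_def)
  have cpt: "compactin X (topspace X \<inter> \<Inter>\<G>)" if "finite \<G>" "\<G> \<subseteq> \<K>" for \<G>
    using compact_open_Inter[OF X that(1)] K that(2) unfolding compact_open_def by blast
  have "\<exists>M\<in>A. \<forall>V\<in>A. M \<subseteq> V \<longrightarrow> V = M"
  proof (rule subset_Zorn_nonempty)
    \<comment> \<open>A finite intersection of compact opens is compact, so covering it by \<U>
      would leave a finite subcover and contradict \<open>contra\<close>.\<close>
    have "\<not> topspace X \<inter> \<Inter>\<G> \<subseteq> \<Union>\<U>" if G: "finite \<G>" "\<G> \<subseteq> \<K>" for \<G>
    proof
      assume "topspace X \<inter> \<Inter>\<G> \<subseteq> \<Union>\<U>"
      then obtain \<F> where "finite \<F>" "\<F> \<subseteq> \<U>" "topspace X \<inter> \<Inter>\<G> \<subseteq> \<Union>\<F>"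
        using cpt[OF G] U unfolding compactin_def by meson
      with contra G show False by blast
    qed
    then have "\<Union>\<U> \<in> A" using U by (auto simp: memA)
    then show "A \<noteq> {}" by blast
    fix \<C> assume C: "\<C> \<noteq> {}" "subset.chain A \<C>"
    then have CA: "\<C> \<subseteq> A" by (simp add: subset.chain_def)
    have "\<not> topspace X \<inter> \<Inter>\<G> \<subseteq> \<Union>\<C>" if G: "finite \<G>" "\<G> \<subseteq> \<K>" for \<G>
    proof
      assume "topspace X \<inter> \<Inter>\<G> \<subseteq> \<Union>\<C>"
      moreover have "\<forall>V\<in>\<C>. openin X V" using CA memA by blast
      ultimately obtain \<F> where F: "finite \<F>" "\<F> \<subseteq> \<C>" "topspace X \<inter> \<Inter>\<G> \<subseteq> \<Union>\<F>"
        using cpt[OF G] unfolding compactin_def by meson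
      \<comment> \<open>A non-empty finite subfamily of a chain has a largest member; if \<F> is
        empty, any member of the non-empty chain serves.\<close>
      obtain V where "V \<in> \<C>" "\<Union>\<F> \<subseteq> V"
      proof (cases "\<F> = {}")
        case False
        have "subset.chain A \<F>" using C(2) F(2) unfolding subset.chain_def by blast
        then have "\<Union>\<F> \<in> \<F>" using F(1) False by (intro Union_in_chain) auto
        then show thesis using that F(2) by blast
      qed (use that C(1) in blast)
      have "\<not> topspace X \<inter> \<Inter>\<G> \<subseteq> V" using subsetD[OF CA \<open>V \<in> \<C>\<close>] G by (simp add: memA)
      with F(3) \<open>\<Union>\<F> \<subseteq> V\<close> show False by blast
    qed
    moreover have "\<Union>\<U> \<subseteq> \<Union>\<C>" using C(1) subsetD[OF CA] by (auto simp: memA)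
    moreover have "openin X (\<Union>\<C>)" using subsetD[OF CA] by (intro openin_Union) (simp add: memA)
    ultimately show "\<Union>\<C> \<in> A" by (simp add: memA)
  qed
  then obtain M where "M \<in> A" and max: "\<And>V. V \<in> A \<Longrightarrow> M \<subseteq> V \<Longrightarrow> V = M" by blast
  then have M: "openin X M" "\<Union>\<U> \<subseteq> M"
    and not_M: "\<And>\<G>. finite \<G> \<Longrightarrow> \<G> \<subseteq> \<K> \<Longrightarrow> \<not> topspace X \<inter> \<Inter>\<G> \<subseteq> M"
    by (simp_all add: memA)
  let ?C = "topspace X - M"
  have "irreducible_closed_in X ?C"
    unfolding irreducible_closed_in_def
  proof (intro conjI allI impI)
    show "closedin X ?C" using M(1) by blast
    have "\<not> topspace X \<inter> \<Inter>{} \<subseteq> M" by (rule not_M) simp_all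
    then show "?C \<noteq> {}" by auto
    fix Y Y' assume Y: "closedin X Y" and Y': "closedin X Y'" and YY': "?C = Y \<union> Y'"
    show "?C = Y \<or> ?C = Y'"
    proof (rule ccontr)
      assume neq: "\<not> (?C = Y \<or> ?C = Y')"
      \<comment> \<open>The complement of a closed \<open>Z\<close> properly inside
        \<open>?C\<close> is an open set properly containing \<open>M\<close>. By maximality it is
        not in \<open>A\<close>, so it covers a finite intersection. Applied to \<open>Y\<close> and
        \<open>Y'\<close>, this lets \<open>M\<close> cover the combined intersection, which is
        impossible.\<close>
      have "\<exists>\<G>. finite \<G> \<and> \<G> \<subseteq> \<K> \<and> topspace X \<inter> \<Inter>\<G> \<subseteq> topspace X - Z"
        if Z: "closedin X Z" "Z \<subseteq> ?C" "Z \<noteq> ?C" for Z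
      proof (rule ccontr)
        assume no: "\<not> ?thesis"
        have MX: "M \<subseteq> topspace X" using M(1) by (rule openin_subset)
        have "openin X (topspace X - Z)" using Z(1) by blast
        moreover have "\<Union>\<U> \<subseteq> topspace X - Z" using Z(2) M(2) MX by blast
        moreover have "\<not> topspace X \<inter> \<Inter>\<G> \<subseteq> topspace X - Z" if "finite \<G>" "\<G> \<subseteq> \<K>" for \<G>
          using no that by blast
        ultimately have "topspace X - Z \<in> A" by (simp add: memA)
        then have "topspace X - Z = M" using Z MX by (intro max) blast+
        then show False using Z closedin_subset[OF Z(1)] by blast
      qed
      note ex = this
      have "Y \<subseteq> ?C" "Y \<noteq> ?C" using YY' neq by auto
      from ex[OF Y this]
      obtain \<G> where G: "finite \<G>" "\<G> \<subseteq> \<K>" "topspace X \<inter> \<Inter>\<G> \<subseteq> topspace X - Y"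
        by meson
      have "Y' \<subseteq> ?C" "Y' \<noteq> ?C" using YY' neq by auto
      from ex[OF Y' this]
      obtain \<H> where H: "finite \<H>" "\<H> \<subseteq> \<K>" "topspace X \<inter> \<Inter>\<H> \<subseteq> topspace X - Y'"
        by meson
      have "topspace X \<inter> \<Inter>(\<G> \<union> \<H>) \<subseteq> M" using G(3) H(3) YY' by blast
      moreover have "finite (\<G> \<union> \<H>)" "\<G> \<union> \<H> \<subseteq> \<K>" using G H by auto
      ultimately show False using not_M by blast
    qed
  qed
  moreover have "sober_space X"
    using X by (simp add: spectral_space_def stably_compact_space_def)
  ultimately have "\<exists>!x. x \<in> topspace X \<and> point_closure X x = ?C"
    by (simp add: sober_space_def)
  then obtain p where p: "p \<in> topspace X" "point_closure X p = ?C"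
    using ex1_implies_ex by meson
  \<comment> \<open>\<open>K\<close> is not covered by \<open>M\<close>, so this open set meets the
    closure of \<open>p\<close> and therefore contains \<open>p\<close>.\<close>
  have "p \<in> K" if "K \<in> \<K>" for K
  proof -
    have "finite {K}" "{K} \<subseteq> \<K>" using that by auto
    then have "\<not> topspace X \<inter> \<Inter>{K} \<subseteq> M" by (rule not_M)
    then obtain q where "q \<in> K" "q \<in> point_closure X p" using p(2) by auto
    then show ?thesis using K[OF that] by (auto simp: in_closure_of compact_open_def)
  qed
  moreover have "p \<in> ?C" using p closure_of_subset[of "{p}" X] by auto
  ultimately show False using cover M(2) p(1) by blast
qed

definition patch_subbasic :: "'a topology \<Rightarrow> 'a set \<Rightarrow> bool" where
  "patch_subbasic X S \<longleftrightarrow> compact_open X S \<or> (\<exists>K. compact_open X K \<and> S = topspace X - K)"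

definition patch :: "'a topology \<Rightarrow> 'a topology" where
  "patch X = topology (arbitrary union_of (finite intersection_of patch_subbasic X relative_to topspace X))"

lemma topspace_patch [simp]: "topspace (patch X) = topspace X"
  by (simp add: patch_def)

lemma patch_subbasic_subset: "patch_subbasic X S \<Longrightarrow> S \<subseteq> topspace X"
  using openin_subset unfolding patch_subbasic_def compact_open_def by blast

lemma openin_patch_subbasic:
  assumes "patch_subbasic X S"
  shows "openin (patch X) S"
proof -
  have "(finite intersection_of patch_subbasic X) S"
    using assms by (rule finite_intersection_of_inc)
  then have "(finite intersection_of patch_subbasic X relative_to topspace X) (topspace X \<inter> S)"
    by (rule relative_to_inc)
  moreover have "topspace X \<inter> S = S" using patch_subbasic_subset[OF assms] by blast
  ultimately show ?thesis
    unfolding patch_def openin_subbase by (simp add: arbitrary_union_of_inc)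
qed

lemma openin_patch:
  assumes "compact_open X K"
  shows "openin (patch X) K" "openin (patch X) (topspace X - K)"
  using assms by (auto intro!: openin_patch_subbasic simp: patch_subbasic_def)

lemma closedin_patch: "compact_open X K \<Longrightarrow> closedin (patch X) K"
  using openin_patch(2)[of X K] openin_subset[of X K] by (simp add: closedin_def compact_open_def)

text \<open>By Alexander's lemma, only covers by compact opens and complements of compact opens
  matter. Such a cover says that the intersection of the complemented sets is covered by the compact
  opens among its members, and \<open>spectral_space_finite_cover\<close> makes both families
  finite.\<close>

lemma compact_space_patch:
  assumes X: "spectral_space X"
  shows "compact_space (patch X)"
proof -
  let ?B = "Collect (patch_subbasic X)"
  have "compact_open X (topspace X)"
    using compact_open_Inter[OF X, of "{}"] by simp
  then have "topspace X \<in> ?B" by (simp add: patch_subbasic_def)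
  then have UB: "\<Union>?B = topspace X" using patch_subbasic_subset by blast
  show ?thesis
  proof (rule Alexander_subbase)
    show "topology (arbitrary union_of (finite intersection_of (\<lambda>x. x \<in> ?B) relative_to \<Union>?B)) = patch X"
      unfolding UB patch_def by simp
    fix C assume C: "C \<subseteq> ?B" "\<Union>C = topspace (patch X)"
    let ?U = "{U \<in> C. compact_open X U}" and ?K = "{K. compact_open X K \<and> topspace X - K \<in> C}"
    have "topspace X \<inter> \<Inter>?K \<subseteq> \<Union>?U"
    proof
      fix x assume x: "x \<in> topspace X \<inter> \<Inter>?K"
      then obtain S where S: "S \<in> C" "x \<in> S" using C(2) by auto
      then have "patch_subbasic X S" using C(1) by blast
      then show "x \<in> \<Union>?U" using S x unfolding patch_subbasic_def by blast
    qed
    then have "\<exists>\<U> \<K>. finite \<U> \<and> \<U> \<subseteq> ?U \<and> finite \<K> \<and> \<K> \<subseteq> ?K \<and> topspace X \<inter> \<Inter>\<K> \<subseteq> \<Union>\<U>"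
      by (intro spectral_space_finite_cover[OF X]) (auto simp: compact_open_def)
    then obtain \<U> \<K> where F: "finite \<U>" "\<U> \<subseteq> ?U" "finite \<K>" "\<K> \<subseteq> ?K"
      "topspace X \<inter> \<Inter>\<K> \<subseteq> \<Union>\<U>"
      by blast
    let ?C = "\<U> \<union> (\<lambda>K. topspace X - K) ` \<K>"
    have "?C \<subseteq> C" using F by auto
    moreover have "topspace X \<subseteq> \<Union>?C" using F(5) by blast
    moreover have "\<Union>?C \<subseteq> topspace X" using Union_mono[OF \<open>?C \<subseteq> C\<close>] C(2) by simp
    moreover have "finite ?C" using F by simp
    ultimately have "finite ?C \<and> ?C \<subseteq> C \<and> \<Union>?C = topspace (patch X)" by (metis subset_antisym topspace_patch)
    then show "\<exists>C'. finite C' \<and> C' \<subseteq> C \<and> \<Union>C' = topspace (patch X)" by (rule exI)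
  qed
qed

lemma is_patch_patch:
  assumes X: "spectral_space X"
  shows "is_patch (patch X) X"
  unfolding is_patch_def
proof (intro conjI allI impI)
  fix U assume U: "openin X U"
  show "openin (patch X) U"
  proof (subst openin_subopen, rule ballI)
    fix p assume "p \<in> U"
    then obtain K where "compact_open X K" "p \<in> K" "K \<subseteq> U" by (rule spectral_space_base[OF X U])
    then show "\<exists>T. openin (patch X) T \<and> p \<in> T \<and> T \<subseteq> U" using openin_patch(1) by blast
  qed
  fix p assume "p \<in> U"
  then obtain K where K: "compact_open X K" "p \<in> K" "K \<subseteq> U" by (rule spectral_space_base[OF X U])
  then have "openin X K" "closedin (patch X) K" using closedin_patch by (auto simp: compact_open_def)
  with K show "\<exists>N. openin X N \<and> closedin (patch X) N \<and> p \<in> N \<and> N \<subseteq> U" by blast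
qed (use compact_space_patch[OF X] in simp_all)

lemma compact_open_preimage:
  assumes "spectral_map X Y f" "compact_open Y K"
  shows "compact_open X {x \<in> topspace X. f x \<in> K}"
proof -
  have "saturated_in Y K" using assms(2) by (simp add: compact_open_def saturated_in_openin)
  moreover have "openin X {x \<in> topspace X. f x \<in> K}"
    using assms by (intro openin_continuous_map_preimage[of X Y]) (simp_all add: spectral_map_def compact_open_def)
  ultimately show ?thesis using assms by (simp add: spectral_map_def compact_open_def)
qed

text \<open>Compact opens are saturated, so a spectral map pulls them back to compact opens;
  preimages also respect complements, which settles the whole subbase.\<close>

lemma continuous_map_patch:
  assumes f: "spectral_map X Y f"
  shows "continuous_map (patch X) (patch Y) f"
  unfolding patch_def[of Y]
proof (rule continuous_map_into_topology_subbase)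
  have f_fun: "f x \<in> topspace Y" if "x \<in> topspace X" for x
    using f that by (auto simp: spectral_map_def continuous_map_def)
  then show "f x \<in> topspace (topology (arbitrary union_of
      (finite intersection_of patch_subbasic Y relative_to topspace Y)))"
    if "x \<in> topspace (patch X)" for x
    using that by simp
  fix S assume "patch_subbasic Y S"
  then show "openin (patch X) {x \<in> topspace (patch X). f x \<in> S}"
    unfolding patch_subbasic_def
  proof (elim disjE exE conjE)
    assume "compact_open Y S"
    then show ?thesis using openin_patch(1)[OF compact_open_preimage[OF f]] by simp
  next
    fix K assume K: "compact_open Y K" "S = topspace Y - K"
    then have "{x \<in> topspace (patch X). f x \<in> S} = topspace X - {x \<in> topspace X. f x \<in> K}"
      using f_fun by auto
    then show ?thesis using openin_patch(2)[OF compact_open_preimage[OF f K(1)]] by simp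
  qed
qed

lemma spec_leI_compact_open:
  assumes "spectral_space X" "\<And>K. compact_open X K \<Longrightarrow> x \<in> K \<Longrightarrow> y \<in> K"
  shows "spec_le X x y"
  unfolding spec_le_iff
proof (intro allI impI)
  fix U assume "openin X U" "x \<in> U"
  then obtain K where "compact_open X K" "x \<in> K" "K \<subseteq> U" by (rule spectral_space_base[OF assms(1)])
  then show "y \<in> U" using assms(2) by blast
qed

text \<open>Open sets here are preimages, so a cover of \<open>A\<close> comes from a cover of its
  image, and a finite subcover pulls back.\<close>

lemma compact_space_pullback_topology:
  assumes "compactin T (f ` A)"
  shows "compact_space (pullback_topology A f T)"
proof -
  have top: "topspace (pullback_topology A f T) = A"
    using compactin_subset_topspace[OF assms] by (auto simp: topspace_pullback_topology)
  show ?thesis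
    unfolding compact_space_def top compactin_def
  proof (intro conjI allI impI, goal_cases)
    case (2 \<U>)
    then obtain V where V: "\<And>U. U \<in> \<U> \<Longrightarrow> openin T (V U) \<and> U = f -` V U \<inter> A"
      unfolding openin_pullback_topology by metis
    have "f ` A \<subseteq> \<Union>(V ` \<U>)" using 2 V by blast
    moreover have "\<forall>W\<in>V ` \<U>. openin T W" using V by blast
    ultimately obtain \<F> where F: "finite \<F>" "\<F> \<subseteq> V ` \<U>" "f ` A \<subseteq> \<Union>\<F>"
      using assms unfolding compactin_def by meson
    then obtain \<G> where G: "finite \<G>" "\<G> \<subseteq> \<U>" "\<F> = V ` \<G>"
      by (meson finite_subset_image)
    have "A \<subseteq> \<Union>\<G>"
    proof
      fix x assume x: "x \<in> A"
      then obtain U where "U \<in> \<G>" "f x \<in> V U" using F(3) G(3) by blast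
      then show "x \<in> \<Union>\<G>" using V G(2) x by blast
    qed
    with G show ?case by blast
  qed simp
qed

section \<open>The patch of a limit of spectral spaces\<close>

locale spectral_inserter = inserter +
  assumes spectral: "i \<in> I \<Longrightarrow> spectral_space (X i)"
    and spectral_arrow: "(i, j, k, f, g) \<in> R \<Longrightarrow>
      spectral_map (X i) (X k) f \<and> spectral_map (X j) (X k) g"
begin

text \<open>Built from the patches of the \<open>X i\<close> rather than as \<open>patch L\<close>,
  whose compactness would presuppose that \<open>L\<close> is spectral.\<close>

definition patch_limit :: "'c topology" where
  "patch_limit = pullback_topology (topspace L) (tuple I l) (product_topology (\<lambda>i. patch (X i)) I)"

text \<open>A family outside violates a constraint, witnessed by a compact open \<open>K\<close>
  containing \<open>f (\<phi> i)\<close> but not \<open>g (\<phi> j)\<close>. Requiring this of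
  \<open>K\<close> at the coordinates \<open>i\<close> and \<open>j\<close> is a patch-open
  condition since \<open>f\<close> and \<open>g\<close> are spectral, and no compatible family
  satisfies it since \<open>K\<close> is an upper set.\<close>

lemma closedin_tuples:
  "closedin (product_topology (\<lambda>i. patch (X i)) I) (tuple I l ` topspace L)"
  (is "closedin ?T ?S")
  unfolding closedin_def
proof
  have top: "topspace ?T = Pi\<^sub>E I (\<lambda>i. topspace (X i))" by simp
  show sub: "?S \<subseteq> topspace ?T" using proj by (auto simp: tuple_def)
  show "openin ?T (topspace ?T - ?S)"
  proof (subst openin_subopen, rule ballI)
    fix \<phi> assume \<phi>: "\<phi> \<in> topspace ?T - ?S"
    then have \<phi>_PiE: "\<phi> \<in> Pi\<^sub>E I (\<lambda>i. topspace (X i))" by simp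
    have "\<exists>(i, j, k, f, g)\<in>R. \<not> spec_le (X k) (f (\<phi> i)) (g (\<phi> j))"
    proof (rule ccontr)
      assume "\<not> ?thesis"
      then obtain p where p: "p \<in> topspace L" "\<forall>i\<in>I. l i p = \<phi> i"
        using surj[of \<phi>] \<phi> by fastforce
      have "tuple I l p = \<phi>"
      proof
        fix i show "tuple I l p i = \<phi> i"
          using p(2) PiE_arb[OF \<phi>_PiE] by (cases "i \<in> I") (simp_all add: tuple_def)
      qed
      then show False using \<phi> p(1) by blast
    qed
    then obtain i j k f g where r: "(i, j, k, f, g) \<in> R" "\<not> spec_le (X k) (f (\<phi> i)) (g (\<phi> j))"
      by blast
    note ijk = indices[OF r(1)] and fg = spectral_arrow[OF r(1)]
    from spec_leI_compact_open[of "X k"] spectral[of k] ijk r(2)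
    obtain K where K: "compact_open (X k) K" "f (\<phi> i) \<in> K" "g (\<phi> j) \<notin> K" by blast
    let ?F = "{x \<in> topspace (X i). f x \<in> K}" and ?G = "topspace (X j) - {x \<in> topspace (X j). g x \<in> K}"
    let ?N = "{\<psi> \<in> topspace ?T. \<psi> i \<in> ?F} \<inter> {\<psi> \<in> topspace ?T. \<psi> j \<in> ?G}"
    have "openin (patch (X i)) ?F" "openin (patch (X j)) ?G"
      using openin_patch compact_open_preimage fg K(1) by blast+
    then have "openin ?T ?N"
      using ijk by (intro openin_Int openin_continuous_map_preimage[OF continuous_map_product_projection]) auto
    moreover have "\<phi> \<in> ?N" using \<phi>_PiE PiE_mem[OF \<phi>_PiE] K ijk by simp
    moreover have "?N \<subseteq> topspace ?T - ?S"
    proof -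
      have "tuple I l p \<notin> ?N" if "p \<in> topspace L" for p
        using constraint[OF r(1) that] K(1) ijk by (auto simp: tuple_def spec_le_iff compact_open_def)
      then show ?thesis by blast
    qed
    ultimately show "\<exists>N. openin ?T N \<and> \<phi> \<in> N \<and> N \<subseteq> topspace ?T - ?S" by blast
  qed
qed

lemma topspace_patch_limit [simp]: "topspace patch_limit = topspace L"
  using proj by (auto simp: patch_limit_def topspace_pullback_topology tuple_def)

lemma compact_space_patch_limit: "compact_space patch_limit"
  unfolding patch_limit_def
proof (rule compact_space_pullback_topology, rule closedin_compact_space[OF _ closedin_tuples])
  show "compact_space (product_topology (\<lambda>i. patch (X i)) I)"
    unfolding compact_space_product_topology using compact_space_patch[OF spectral] by blast
qed

lemma continuous_map_patch_proj: "i \<in> I \<Longrightarrow> continuous_map patch_limit (patch (X i)) (l i)"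
  unfolding patch_limit_def by (rule continuous_map_pullback_tuple)

text \<open>Each of the finitely many proper sides of a box around \<open>p\<close> shrinks to a
  compact open set, which is clopen in the patch of its factor. The remaining sides are whole spaces
  and impose nothing.\<close>

lemma ex_clopen_nbhd:
  assumes "openin L U" "p \<in> U"
  shows "\<exists>N. openin L N \<and> openin patch_limit N \<and> closedin patch_limit N \<and> p \<in> N \<and> N \<subseteq> U"
proof -
  have p: "p \<in> topspace L" using assms openin_subset by blast
  from assms obtain V where V: "finite {i \<in> I. V i \<noteq> topspace (X i)}"
    "\<And>i. i \<in> I \<Longrightarrow> openin (X i) (V i)" "\<And>i. i \<in> I \<Longrightarrow> l i p \<in> V i"
    and VU: "\<And>q. q \<in> topspace L \<Longrightarrow> (\<And>i. i \<in> I \<Longrightarrow> l i q \<in> V i) \<Longrightarrow> q \<in> U"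
    by (rule openinE) blast
  let ?J = "{i \<in> I. V i \<noteq> topspace (X i)}"
  have "\<exists>K. compact_open (X i) K \<and> l i p \<in> K \<and> K \<subseteq> V i" if "i \<in> I" for i
    using spectral_space_base[OF spectral[OF that] V(2,3)[OF that]] by metis
  then obtain K where K: "\<And>i. i \<in> I \<Longrightarrow> compact_open (X i) (K i) \<and> l i p \<in> K i \<and> K i \<subseteq> V i"
    by metis
  define N where "N J = {q \<in> topspace L. \<forall>i\<in>J. l i q \<in> K i}" for J
  have clopen: "openin L (N J) \<and> openin patch_limit (N J) \<and> closedin patch_limit (N J)"
    if "finite J" "J \<subseteq> I" for J
    using that
  proof (induction J)
    case empty
    show ?case using openin_topspace[of patch_limit] closedin_topspace[of patch_limit] by (simp add: N_def)
  next
    case (insert i J)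
    then have i: "i \<in> I" by simp
    let ?M = "{q \<in> topspace L. l i q \<in> K i}"
    have "openin L ?M"
      using K[OF i] openin_continuous_map_preimage[OF continuous_proj[OF i]] by (simp add: compact_open_def)
    moreover have "openin patch_limit ?M" "closedin patch_limit ?M"
      using openin_continuous_map_preimage[OF continuous_map_patch_proj[OF i] openin_patch(1)[of _ "K i"]]
        closedin_continuous_map_preimage[OF continuous_map_patch_proj[OF i] closedin_patch[of _ "K i"]] K[OF i]
      by simp_all
    moreover have "N (insert i J) = ?M \<inter> N J" by (auto simp: N_def)
    ultimately show ?case using insert by auto
  qed
  have "N ?J \<subseteq> U"
  proof
    fix q assume q: "q \<in> N ?J"
    then have qL: "q \<in> topspace L" by (simp add: N_def)
    show "q \<in> U"
    proof (rule VU[OF qL])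
      fix i assume i: "i \<in> I"
      show "l i q \<in> V i"
        using q K[OF i] proj[OF i qL] i by (cases "V i = topspace (X i)") (auto simp: N_def)
    qed
  qed
  moreover have "p \<in> N ?J" using p K by (simp add: N_def)
  ultimately show ?thesis using clopen[OF V(1)] by blast
qed

lemma is_patch_patch_limit: "is_patch patch_limit L"
  unfolding is_patch_def
proof (intro conjI allI impI)
  show "openin patch_limit U" if "openin L U" for U
    using ex_clopen_nbhd[OF that] by (subst openin_subopen) meson
  show "\<exists>N. openin L N \<and> closedin patch_limit N \<and> p \<in> N \<and> N \<subseteq> U" if "openin L U" "p \<in> U" for U p
    using ex_clopen_nbhd[OF that] by meson
qed (simp_all add: compact_space_patch_limit)

lemma spectral_space_limit: "spectral_space L"
  by (rule spectral_space_if_is_patch[OF is_patch_patch_limit t0_limit])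

lemma spectral_map_proj: "i \<in> I \<Longrightarrow> spectral_map L (X i) (l i)"
  by (rule spectral_map_if_continuous_map_patch[OF is_patch_patch_limit is_patch_patch])
    (simp_all add: spectral continuous_proj continuous_map_patch_proj)

text \<open>\<open>L\<close> and \<open>patch_limit\<close> both carry initial topologies, so the
  two continuity conditions for \<open>t\<close> reduce to those for the \<open>a i\<close>.\<close>

lemma spectral_map_mediating:
  assumes t: "t \<in> topspace A \<rightarrow> topspace L" and A: "spectral_space A"
    and a: "\<And>i. i \<in> I \<Longrightarrow> spectral_map A (X i) (a i)"
    and eq: "\<And>i p. i \<in> I \<Longrightarrow> p \<in> topspace A \<Longrightarrow> a i p = l i (t p)"
  shows "spectral_map A L t"
proof (rule spectral_map_if_continuous_map_patch[OF is_patch_patch[OF A] is_patch_patch_limit])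
  show "continuous_map A L t"
    using a t by (subst initial, intro continuous_map_tuple[where a = a]) (simp_all add: spectral_map_def eq)
  show "continuous_map (patch A) patch_limit t"
    unfolding patch_limit_def
    by (rule continuous_map_tuple[where a = a]) (simp_all add: t a eq continuous_map_patch)
qed

end

section \<open>Weighted limits of spaces\<close>

lemma t0_space_if_in_cat:
  assumes "in_cat C X"
  shows "t0_space X"
proof (cases C)
  case Spec
  then have "sober_space X" using assms by (simp add: spectral_space_def stably_compact_space_def)
  then show ?thesis by (rule t0_space_if_sober_space)
qed (use assms t0_space_if_partial_order[of X] in \<open>auto simp: algebraic_lattice_def algebraic_domain_def dcpo_def\<close>)

lemma is_arrow_funcset: "is_arrow C X Y f \<Longrightarrow> f \<in> topspace X \<rightarrow> topspace Y"
  by (cases C) (auto simp: spectral_map_def preserves_directed_sups_def continuous_map_def)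

lemma is_arrow_id: "is_arrow C X X id"
proof (cases C)
  case Spec
  have "{x \<in> topspace X. id x \<in> K} = K" if "compactin X K" for K
    using compactin_subset_topspace[OF that] by auto
  then show ?thesis using Spec by (simp add: spectral_map_def)
qed (simp_all add: preserves_directed_sups_def preserves_infs_def preserves_nonempty_infs_def)

section \<open>Weighted cones as families subject to inequalities\<close>

definition cone_index :: "('o, 'm) ocat \<Rightarrow> ('o \<Rightarrow> 'w gorder) \<Rightarrow> ('o \<times> 'w) set" where
  "cone_index D W = (SIGMA d:objs D. carrier (W d))"

text \<open>The third index only names the space in which the comparison takes place. It must itself
  be an index, so one already present over the right object is reused.\<close>

definition cone_constraints ::
    "('o, 'm) ocat \<Rightarrow> ('o \<Rightarrow> 'w gorder) \<Rightarrow> ('m \<Rightarrow> 'w \<Rightarrow> 'w) \<Rightarrow> ('m \<Rightarrow> 'x \<Rightarrow> 'x) \<Rightarrow>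
      (('o \<times> 'w) \<times> ('o \<times> 'w) \<times> ('o \<times> 'w) \<times> ('x \<Rightarrow> 'x) \<times> ('x \<Rightarrow> 'x)) set" where
  "cone_constraints D W Wm Fm =
     {((d, x), (d, y), (d, y), id, id) | d x y.
        d \<in> objs D \<and> x \<in> carrier (W d) \<and> y \<in> carrier (W d) \<and> x \<sqsubseteq>\<^bsub>W d\<^esub> y} \<union>
     {((d, x), (d', Wm n x), (d', Wm n x), Fm n, id) | d d' n x.
        d \<in> objs D \<and> d' \<in> objs D \<and> n \<in> homset D d d' \<and> x \<in> carrier (W d)} \<union>
     {((d', Wm n x), (d, x), (d', Wm n x), id, Fm n) | d d' n x.
        d \<in> objs D \<and> d' \<in> objs D \<and> n \<in> homset D d d' \<and> x \<in> carrier (W d)}"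

lemma cone_constraints_mono:
  assumes "d \<in> objs D" "x \<in> carrier (W d)" "y \<in> carrier (W d)" "x \<sqsubseteq>\<^bsub>W d\<^esub> y"
  shows "((d, x), (d, y), (d, y), id, id) \<in> cone_constraints D W Wm Fm"
  using assms unfolding cone_constraints_def by blast

lemma cone_constraints_natural:
  assumes "d \<in> objs D" "d' \<in> objs D" "n \<in> homset D d d'" "x \<in> carrier (W d)"
  shows "((d, x), (d', Wm n x), (d', Wm n x), Fm n, id) \<in> cone_constraints D W Wm Fm"
    and "((d', Wm n x), (d, x), (d', Wm n x), id, Fm n) \<in> cone_constraints D W Wm Fm"
  using assms unfolding cone_constraints_def by blast+

lemma cone_constraintsE [consumes 1, case_names mono natural_le natural_ge]:
  assumes "(i, j, k, f, g) \<in> cone_constraints D W Wm Fm"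
  obtains (mono) d x y where "i = (d, x)" "j = (d, y)" "k = (d, y)" "f = id" "g = id"
      "d \<in> objs D" "x \<in> carrier (W d)" "y \<in> carrier (W d)" "x \<sqsubseteq>\<^bsub>W d\<^esub> y"
    | (natural_le) d d' n x where "i = (d, x)" "j = (d', Wm n x)" "k = (d', Wm n x)" "f = Fm n" "g = id"
      "d \<in> objs D" "d' \<in> objs D" "n \<in> homset D d d'" "x \<in> carrier (W d)"
    | (natural_ge) d d' n x where "i = (d', Wm n x)" "j = (d, x)" "k = (d', Wm n x)" "f = id" "g = Fm n"
      "d \<in> objs D" "d' \<in> objs D" "n \<in> homset D d d'" "x \<in> carrier (W d)"
  using assms unfolding cone_constraints_def Un_iff mem_Collect_eq prod.inject
  by (elim disjE exE conjE) (rule that; assumption)+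

abbreviation index_space :: "('o \<Rightarrow> 'x topology) \<Rightarrow> 'o \<times> 'w \<Rightarrow> 'x topology" where
  "index_space F \<equiv> \<lambda>i. F (fst i)"

locale weighted_diagram = weight D W Wm + diagram C D F Fm
  for C :: space_cat and D :: "('o, 'm) ocat" and W :: "'o \<Rightarrow> 'w gorder" and Wm
    and F :: "'o \<Rightarrow> 'x topology" and Fm
begin

abbreviation "J \<equiv> cone_index D W"
abbreviation "R \<equiv> cone_constraints D W Wm Fm"

lemma t0_diagram: "i \<in> J \<Longrightarrow> t0_space (index_space F i)"
  using t0_space_if_in_cat[OF diagram_obj] by (auto simp: cone_index_def)

lemma weight_map_closed: "n \<in> homset D d d' \<Longrightarrow> x \<in> carrier (W d) \<Longrightarrow> Wm n x \<in> carrier (W d')"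
  using weight_map by blast

lemma constraint_arrows:
  assumes "(i, j, k, f, g) \<in> R"
  shows "i \<in> J \<and> j \<in> J \<and> k \<in> J \<and>
    is_arrow C (index_space F i) (index_space F k) f \<and> is_arrow C (index_space F j) (index_space F k) g"
  using assms
proof (cases rule: cone_constraintsE)
  case (mono d x y)
  then show ?thesis by (simp add: cone_index_def is_arrow_id)
next
  case (natural_le d d' n x)
  then show ?thesis
    by (simp add: cone_index_def is_arrow_id diagram_map[OF natural_le(8)] weight_map_closed[OF natural_le(8)])
next
  case (natural_ge d d' n x)
  then show ?thesis
    by (simp add: cone_index_def is_arrow_id diagram_map[OF natural_ge(8)] weight_map_closed[OF natural_ge(8)])
qed

lemma cone_satisfies_constraints:
  assumes a: "weighted_cone C' D W Wm F Fm A a" and "p \<in> topspace A" and "(i, j, k, f, g) \<in> R"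
  shows "spec_le (index_space F k) (f (case_prod a i p)) (g (case_prod a j p))"
  using assms(3)
proof (cases rule: cone_constraintsE)
  case (mono d x y)
  then show ?thesis using a assms(2) by (simp add: weighted_cone_def arrow_le_def)
next
  case (natural_le d d' n x)
  then have "Fm n (a d x p) = a d' (Wm n x) p"
    using a assms(2) by (simp add: weighted_cone_def arrow_eq_def)
  then show ?thesis using natural_le by (simp add: spec_le_refl)
next
  case (natural_ge d d' n x)
  then have "Fm n (a d x p) = a d' (Wm n x) p"
    using a assms(2) by (simp add: weighted_cone_def arrow_eq_def)
  then show ?thesis using natural_ge by (simp add: spec_le_refl)
qed

text \<open>The two inequalities of a naturality constraint merge into an equation because the
  spaces of the diagram are T0. The category \<open>C'\<close> is independent of the one of the
  diagram, so that the same legs can be read as a cone in \<open>Top0\<close> and in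
  \<open>C\<close>.\<close>

lemma weighted_cone_iff:
  "weighted_cone C' D W Wm F Fm A a \<longleftrightarrow>
    (\<forall>i\<in>J. is_arrow C' A (index_space F i) (case_prod a i)) \<and>
    (\<forall>p\<in>topspace A. \<forall>(i, j, k, f, g)\<in>R.
      spec_le (index_space F k) (f (case_prod a i p)) (g (case_prod a j p)))"
  (is "_ \<longleftrightarrow> ?arrows \<and> ?constraints")
proof
  assume "weighted_cone C' D W Wm F Fm A a"
  then show "?arrows \<and> ?constraints"
    using cone_satisfies_constraints[of C' A a] by (auto simp: weighted_cone_def cone_index_def)
next
  assume *: "?arrows \<and> ?constraints"
  have con: "spec_le (index_space F k) (f (case_prod a i p)) (g (case_prod a j p))"
    if "(i, j, k, f, g) \<in> R" "p \<in> topspace A" for i j k f g p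
    using * that by blast
  have a_fun: "a d x p \<in> topspace (F d)"
    if "d \<in> objs D" "x \<in> carrier (W d)" "p \<in> topspace A" for d x p
    using * is_arrow_funcset[of C' A "F d" "a d x"] that by (auto simp: cone_index_def)
  show "weighted_cone C' D W Wm F Fm A a"
    unfolding weighted_cone_def
  proof (intro conjI ballI impI)
    fix d x assume d: "d \<in> objs D" and x: "x \<in> carrier (W d)"
    then show "is_arrow C' A (F d) (a d x)" using * by (auto simp: cone_index_def)
    show "arrow_le A (F d) (a d x) (a d y)" if "y \<in> carrier (W d)" "x \<sqsubseteq>\<^bsub>W d\<^esub> y" for y
      using con[OF cone_constraints_mono[where W = W, OF d x that]] by (simp add: arrow_le_def)
    fix d' n assume d': "d' \<in> objs D" and n: "n \<in> homset D d d'"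
    show "arrow_eq A (Fm n \<circ> a d x) (a d' (Wm n x))"
      unfolding arrow_eq_def
    proof
      fix p assume p: "p \<in> topspace A"
      have "Fm n (a d x p) = a d' (Wm n x) p"
      proof (rule spec_le_antisym)
        show "t0_space (F d')" using diagram_obj[OF d'] by (rule t0_space_if_in_cat)
        show "Fm n (a d x p) \<in> topspace (F d')"
          using is_arrow_funcset[OF diagram_map[OF n]] a_fun[OF d x p] by blast
        show "a d' (Wm n x) p \<in> topspace (F d')"
          using a_fun[OF d' weight_map_closed[OF n x] p] .
        show "spec_le (F d') (Fm n (a d x p)) (a d' (Wm n x) p)"
          using con[OF cone_constraints_natural(1)[where W = W, OF d d' n x] p] by simp
        show "spec_le (F d') (a d' (Wm n x) p) (Fm n (a d x p))"
          using con[OF cone_constraints_natural(2)[where W = W, OF d d' n x] p] by simp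
      qed
      then show "(Fm n \<circ> a d x) p = a d' (Wm n x) p" by simp
    qed
  qed
qed

end

section \<open>Points and topology of a limit of T0 spaces\<close>

locale top_limit = weighted_diagram C D W Wm F Fm
  for C :: space_cat and D :: "('o, 'm) ocat" and W :: "'o \<Rightarrow> 'w gorder" and Wm
    and F :: "'o \<Rightarrow> 'x topology" and Fm +
  fixes L :: "'l topology" and l :: "'o \<Rightarrow> 'w \<Rightarrow> 'l \<Rightarrow> 'x"
  assumes limit: "weighted_limit Top0 TYPE('l) D W Wm F Fm L l"
begin

lemma t0_L: "t0_space L"
  and cone_L: "weighted_cone Top0 D W Wm F Fm L l"
  using limit by (simp_all add: weighted_limit_def)

lemma ex_mediating:
  assumes "t0_space (A :: 'l topology)" "weighted_cone Top0 D W Wm F Fm A a"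
  obtains t where "continuous_map A L t" "\<And>i p. i \<in> J \<Longrightarrow> p \<in> topspace A \<Longrightarrow> case_prod a i p = case_prod l i (t p)"
proof -
  have "in_cat Top0 A" using assms(1) by simp
  from limit[unfolded weighted_limit_def, THEN conjunct2, THEN conjunct2, THEN spec, THEN mp, OF this,
      THEN conjunct1, THEN spec, THEN mp, OF assms(2)]
  obtain t where t: "is_arrow Top0 A L t"
    "\<forall>d\<in>objs D. \<forall>x\<in>carrier (W d). arrow_eq A (a d x) (l d x \<circ> t)"
    by meson
  show thesis
  proof
    show "continuous_map A L t" using t(1) by simp
    show "case_prod a i p = case_prod l i (t p)" if "i \<in> J" "p \<in> topspace A" for i p
      using t(2) that by (auto simp: cone_index_def arrow_eq_def)
  qed
qed

lemma spec_le_if_mediating: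
  assumes "t0_space (A :: 'l topology)" "continuous_map A L t" "continuous_map A L t'"
    and "\<And>i p. i \<in> J \<Longrightarrow> p \<in> topspace A \<Longrightarrow>
      spec_le (index_space F i) (case_prod l i (t p)) (case_prod l i (t' p))"
    and "p \<in> topspace A"
  shows "spec_le L (t p) (t' p)"
proof -
  have "\<forall>d\<in>objs D. \<forall>x\<in>carrier (W d). arrow_le A (F d) (l d x \<circ> t) (l d x \<circ> t')"
    using assms(4) by (fastforce simp: cone_index_def arrow_le_def)
  moreover have "in_cat Top0 A" "is_arrow Top0 A L t" "is_arrow Top0 A L t'" using assms(1-3) by simp_all
  note limit[unfolded weighted_limit_def, THEN conjunct2, THEN conjunct2, THEN spec, THEN mp, OF this(1),
      THEN conjunct2, THEN spec, THEN spec, THEN mp, THEN mp, OF this(2,3), THEN mp]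
  ultimately have "arrow_le A L t t'" by blast
  then show ?thesis using assms(5) by (simp add: arrow_le_def)
qed

lemma continuous_L: "i \<in> J \<Longrightarrow> continuous_map L (index_space F i) (case_prod l i)"
  using cone_L by (auto simp: weighted_cone_iff)

text \<open>The order part of the universal property, applied in both directions to the constant
  maps with values \<open>p\<close> and \<open>q\<close>, followed by antisymmetry.\<close>

lemma inj_L:
  assumes p: "p \<in> topspace L" and q: "q \<in> topspace L"
    and eq: "\<And>i. i \<in> J \<Longrightarrow> case_prod l i p = case_prod l i q"
  shows "p = q"
proof -
  \<comment> \<open>Test objects must have points of type \<open>'l\<close>;
    \<open>undefined\<close> is merely some element of it.\<close>
  let ?A = "discrete_topology {undefined :: 'l}"
  have A: "t0_space ?A" by (simp add: t0_space_discrete_topology)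
  have "spec_le L ((\<lambda>_. p) undefined) ((\<lambda>_. q) undefined)"
    by (rule spec_le_if_mediating[OF A]) (simp_all add: p q eq spec_le_refl)
  moreover have "spec_le L ((\<lambda>_. q) undefined) ((\<lambda>_. p) undefined)"
    by (rule spec_le_if_mediating[OF A]) (simp_all add: p q eq spec_le_refl)
  ultimately show ?thesis using spec_le_antisym[OF t0_L p q] by simp
qed

text \<open>A compatible family is the same as a cone of constant maps on a one-point space; the
  mediating map picks the desired point.\<close>

lemma surj_L:
  assumes s: "\<And>i. i \<in> J \<Longrightarrow> s i \<in> topspace (index_space F i)"
    and con: "\<And>i j k f g. (i, j, k, f, g) \<in> R \<Longrightarrow> spec_le (index_space F k) (f (s i)) (g (s j))"
  shows "\<exists>p\<in>topspace L. \<forall>i\<in>J. case_prod l i p = s i"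
proof -
  let ?A = "discrete_topology {undefined :: 'l}"
  have "weighted_cone Top0 D W Wm F Fm ?A (\<lambda>d x _. s (d, x))"
    unfolding weighted_cone_iff using s con by (auto simp: case_prod_unfold)
  moreover have "t0_space ?A" by (simp add: t0_space_discrete_topology)
  ultimately obtain t where "continuous_map ?A L t"
    "\<And>i p. i \<in> J \<Longrightarrow> p \<in> topspace ?A \<Longrightarrow> case_prod (\<lambda>d x _. s (d, x)) i p = case_prod l i (t p)"
    using ex_mediating[of ?A "\<lambda>d x _. s (d, x)"] by metis
  then have "t undefined \<in> topspace L" "\<forall>i\<in>J. case_prod l i (t undefined) = s i"
    by (auto simp: continuous_map_def case_prod_unfold)
  then show ?thesis by blast
qed

text \<open>The initial topology on the points of \<open>L\<close> makes the projections a cone; mediating it through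
  \<open>L\<close> yields the identity, so the topology of \<open>L\<close> is no finer than the initial one.\<close>

lemma initial_L:
  "L = pullback_topology (topspace L) (tuple J (case_prod l)) (product_topology (index_space F) J)"
  (is "L = ?P")
proof -
  have in_F: "case_prod l i p \<in> topspace (index_space F i)" if "i \<in> J" "p \<in> topspace L" for i p
    using continuous_L[OF that(1)] that(2) by (auto simp: continuous_map_def)
  then have top: "topspace ?P = topspace L"
    by (auto simp: topspace_pullback_topology tuple_def)
  have cont: "continuous_map ?P (index_space F i) (case_prod l i)" if "i \<in> J" for i
    by (rule continuous_map_pullback_tuple[OF that])
  \<comment> \<open>Needed for \<open>?P\<close> to be admissible as a test object: distinct points
    differ in some coordinate by \<open>inj_L\<close>, and the T0 space there separates
    them.\<close>
  have "t0_space ?P"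
    unfolding t0_space_def top
  proof (intro ballI impI)
    fix p q assume p: "p \<in> topspace L" and q: "q \<in> topspace L" and "p \<noteq> q"
    with inj_L obtain i where i: "i \<in> J" "case_prod l i p \<noteq> case_prod l i q" by blast
    then obtain U where "openin (index_space F i) U" "case_prod l i p \<notin> U \<longleftrightarrow> case_prod l i q \<in> U"
      using t0_diagram[OF i(1)] in_F[OF i(1)] p q unfolding t0_space_def by meson
    then have "openin ?P {p \<in> topspace ?P. case_prod l i p \<in> U}"
      "p \<notin> {p \<in> topspace ?P. case_prod l i p \<in> U} \<longleftrightarrow> q \<in> {p \<in> topspace ?P. case_prod l i p \<in> U}"
      using openin_continuous_map_preimage[OF cont[OF i(1)]] p q top by auto
    then show "\<exists>U. openin ?P U \<and> (p \<notin> U) = (q \<in> U)" by (intro exI conjI)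
  qed
  moreover have "weighted_cone Top0 D W Wm F Fm ?P l"
    using cone_L cont unfolding weighted_cone_iff top by simp
  ultimately obtain t where t: "continuous_map ?P L t"
    "\<And>i p. i \<in> J \<Longrightarrow> p \<in> topspace ?P \<Longrightarrow> case_prod l i p = case_prod l i (t p)"
    using ex_mediating[of ?P l] by metis
  have t_id: "t p = p" if "p \<in> topspace L" for p
    using inj_L[of p "t p"] that t top by (force simp: continuous_map_def)
  have "openin ?P U" if U: "openin L U" for U
  proof -
    have "{p \<in> topspace ?P. t p \<in> U} = U"
      using t_id openin_subset[OF U] top by auto
    then show ?thesis using openin_continuous_map_preimage[OF t(1) U] by simp
  qed
  \<comment> \<open>The other inclusion needs only continuity of the projections of
    \<open>L\<close>.\<close>
  moreover have "openin L U" if U: "openin ?P U" for U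
  proof -
    have "continuous_map L ?P id"
      by (rule continuous_map_tuple) (simp_all add: continuous_L)
    from openin_continuous_map_preimage[OF this U] have "openin L {p \<in> topspace L. p \<in> U}" by simp
    moreover have "{p \<in> topspace L. p \<in> U} = U" using openin_subset[OF U] top by auto
    ultimately show ?thesis by simp
  qed
  ultimately show ?thesis unfolding topology_eq by blast
qed

lemma inserter_L: "inserter J (index_space F) R L (case_prod l)"
proof
  show "case_prod l i p \<in> topspace (index_space F i)" if "i \<in> J" "p \<in> topspace L" for i p
    using continuous_L[OF that(1)] that(2) by (auto simp: continuous_map_def)
  show "spec_le (index_space F k) (f (case_prod l i p)) (g (case_prod l j p))"
    if "(i, j, k, f, g) \<in> R" "p \<in> topspace L" for i j k f g p
    using cone_satisfies_constraints[OF cone_L that(2,1)] .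
  show "L = pullback_topology (topspace L) (tuple J (case_prod l)) (product_topology (index_space F) J)"
    by (rule initial_L)
qed (use t0_diagram constraint_arrows inj_L surj_L in blast)+

text \<open>Existence of \<open>t\<close> as a function comes from \<open>surj_L\<close>, its
  uniqueness from \<open>inj_L\<close>, and the order condition from the pointwise order. None of
  these restricts the point type of \<open>A\<close>. What depends on the category is isolated in
  the three assumptions.\<close>

lemma weighted_limitI:
  assumes obj: "in_cat C L" and proj: "\<And>i. i \<in> J \<Longrightarrow> is_arrow C L (index_space F i) (case_prod l i)"
    and mediating: "\<And>(A :: 'a topology) a t. in_cat C A \<Longrightarrow> t \<in> topspace A \<rightarrow> topspace L \<Longrightarrow>
      (\<And>i. i \<in> J \<Longrightarrow> is_arrow C A (index_space F i) (a i)) \<Longrightarrow>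
      (\<And>i p. i \<in> J \<Longrightarrow> p \<in> topspace A \<Longrightarrow> a i p = case_prod l i (t p)) \<Longrightarrow> is_arrow C A L t"
  shows "weighted_limit C TYPE('a) D W Wm F Fm L l"
  unfolding weighted_limit_def
proof (intro conjI allI impI)
  show "weighted_cone C D W Wm F Fm L l"
    using cone_L proj unfolding weighted_cone_iff by blast
  interpret ins: inserter J "index_space F" R L "case_prod l" by (rule inserter_L)
  fix A :: "'a topology" assume A: "in_cat C A"
  {
    fix a assume a: "weighted_cone C D W Wm F Fm A a"
    then have arr: "is_arrow C A (index_space F i) (case_prod a i)" if "i \<in> J" for i
      using that unfolding weighted_cone_iff by blast
    have "\<exists>q\<in>topspace L. \<forall>i\<in>J. case_prod l i q = case_prod a i p" if p: "p \<in> topspace A" for p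
    proof (rule surj_L)
      show "case_prod a i p \<in> topspace (index_space F i)" if "i \<in> J" for i
        using is_arrow_funcset[OF arr[OF that]] p by blast
    qed (use cone_satisfies_constraints[OF a p] in blast)
    then obtain t where t: "\<And>p. p \<in> topspace A \<Longrightarrow> t p \<in> topspace L"
      "\<And>i p. i \<in> J \<Longrightarrow> p \<in> topspace A \<Longrightarrow> case_prod a i p = case_prod l i (t p)"
      by metis
    have "is_arrow C A L t"
      by (rule mediating[of A t "case_prod a"]) (use A t arr in auto)
    moreover have "\<forall>d\<in>objs D. \<forall>x\<in>carrier (W d). arrow_eq A (a d x) (l d x \<circ> t)"
      using t(2) by (fastforce simp: arrow_eq_def cone_index_def)
    moreover have "arrow_eq A t' t"
      if t': "is_arrow C A L t'" "\<forall>d\<in>objs D. \<forall>x\<in>carrier (W d). arrow_eq A (a d x) (l d x \<circ> t')" for t'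
      unfolding arrow_eq_def
    proof
      fix p assume p: "p \<in> topspace A"
      show "t' p = t p"
      proof (rule inj_L)
        show "t' p \<in> topspace L" using is_arrow_funcset[OF t'(1)] p by blast
        show "t p \<in> topspace L" using t(1) p .
        show "case_prod l i (t' p) = case_prod l i (t p)" if "i \<in> J" for i
          using t'(2) t(2)[OF that p] that p by (auto simp: arrow_eq_def cone_index_def)
      qed
    qed
    ultimately show "\<exists>t. is_arrow C A L t \<and>
        (\<forall>d\<in>objs D. \<forall>x\<in>carrier (W d). arrow_eq A (a d x) (l d x \<circ> t)) \<and>
        (\<forall>t'. is_arrow C A L t' \<longrightarrow> (\<forall>d\<in>objs D. \<forall>x\<in>carrier (W d). arrow_eq A (a d x) (l d x \<circ> t')) \<longrightarrow>
          arrow_eq A t' t)"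
      by blast
  }
  fix t t' assume t: "is_arrow C A L t" "is_arrow C A L t'"
    and le: "\<forall>d\<in>objs D. \<forall>x\<in>carrier (W d). arrow_le A (F d) (l d x \<circ> t) (l d x \<circ> t')"
  show "arrow_le A L t t'"
    unfolding arrow_le_def
  proof
    fix p assume p: "p \<in> topspace A"
    have "t p \<in> topspace L" "t' p \<in> topspace L" using is_arrow_funcset t p by blast+
    moreover have "\<forall>i\<in>J. spec_le (index_space F i) (case_prod l i (t p)) (case_prod l i (t' p))"
      using le p by (auto simp: arrow_le_def cone_index_def)
    ultimately show "spec_le L (t p) (t' p)" by (simp add: ins.spec_le_limit_iff)
  qed
qed (rule obj)

end

section \<open>Closure of the three categories\<close>

lemma closed_under_weighted_limitsI:
  assumes "\<And>(D :: ('o, 'm) ocat) (W :: 'o \<Rightarrow> 'w gorder) Wm (F :: 'o \<Rightarrow> 'x topology) Fm (L :: 'l topology) l.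
    top_limit C D W Wm F Fm L l \<Longrightarrow> weighted_limit C TYPE('a) D W Wm F Fm L l"
  shows "closed_under_weighted_limits C TYPE('o \<times> 'm \<times> 'w \<times> 'x \<times> 'l \<times> 'a)"
  unfolding closed_under_weighted_limits_def
proof (intro allI impI)
  fix D :: "('o, 'm) ocat" and W :: "'o \<Rightarrow> 'w gorder" and Wm and F :: "'o \<Rightarrow> 'x topology" and Fm
    and L :: "'l topology" and l
  assume "weight D W Wm" "diagram C D F Fm" "weighted_limit Top0 TYPE('l) D W Wm F Fm L l"
  then have "top_limit C D W Wm F Fm L l"
    by (simp add: top_limit_def top_limit_axioms_def weighted_diagram_def)
  then show "weighted_limit C TYPE('a) D W Wm F Fm L l" by (rule assms)
qed

lemma (in top_limit) diagram_in_cat: "i \<in> J \<Longrightarrow> in_cat C (index_space F i)"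
  using diagram_obj by (auto simp: cone_index_def)

theorem proposition5p1:
  shows "closed_under_weighted_limits ALat TYPE('o \<times> 'm \<times> 'w \<times> 'x \<times> 'l \<times> 'a)
       \<and> closed_under_weighted_limits ADom TYPE('o \<times> 'm \<times> 'w \<times> 'x \<times> 'l \<times> 'a)
       \<and> closed_under_weighted_limits Spec TYPE('o \<times> 'm \<times> 'w \<times> 'x \<times> 'l \<times> 'a)"
proof (intro conjI closed_under_weighted_limitsI)
  fix D :: "('o, 'm) ocat" and W :: "'o \<Rightarrow> 'w gorder" and Wm and F :: "'o \<Rightarrow> 'x topology" and Fm
    and L :: "'l topology" and l
  {
    assume "top_limit ALat D W Wm F Fm L l"
    then interpret top_limit ALat D W Wm F Fm L l .
    interpret inserter J "index_space F" R L "case_prod l" by (rule inserter_L)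
    interpret lattice_inserter J "index_space F" R L "case_prod l"
      by unfold_locales (use diagram_in_cat constraint_arrows in blast)+
    show "weighted_limit ALat TYPE('a) D W Wm F Fm L l"
      using in_ALat_limit is_ALat_arrow_proj is_ALat_arrow_mediating by (rule weighted_limitI)
  next
    assume "top_limit ADom D W Wm F Fm L l"
    then interpret top_limit ADom D W Wm F Fm L l .
    interpret inserter J "index_space F" R L "case_prod l" by (rule inserter_L)
    interpret domain_inserter J "index_space F" R L "case_prod l"
      by unfold_locales (use diagram_in_cat constraint_arrows in blast)+
    show "weighted_limit ADom TYPE('a) D W Wm F Fm L l"
      using in_ADom_limit is_ADom_arrow_proj is_ADom_arrow_mediating by (rule weighted_limitI)
  next
    assume "top_limit Spec D W Wm F Fm L l"
    then interpret top_limit Spec D W Wm F Fm L l .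
    interpret inserter J "index_space F" R L "case_prod l" by (rule inserter_L)
    interpret spectral_inserter J "index_space F" R L "case_prod l"
    proof
      show "spectral_space (index_space F i)" if "i \<in> J" for i
        using diagram_in_cat[OF that] by simp
      show "spectral_map (index_space F i) (index_space F k) f \<and> spectral_map (index_space F j) (index_space F k) g"
        if "(i, j, k, f, g) \<in> R" for i j k f g
        using constraint_arrows[OF that] by simp
    qed
    show "weighted_limit Spec TYPE('a) D W Wm F Fm L l"
    proof (rule weighted_limitI)
      show "in_cat Spec L" using spectral_space_limit by simp
      show "is_arrow Spec L (index_space F i) (case_prod l i)" if "i \<in> J" for i
        using spectral_map_proj[OF that] by simp
      show "is_arrow Spec A L t"
        if "in_cat Spec A" "t \<in> topspace A \<rightarrow> topspace L"
          "\<And>i. i \<in> J \<Longrightarrow> is_arrow Spec A (index_space F i) (a i)"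
          "\<And>i p. i \<in> J \<Longrightarrow> p \<in> topspace A \<Longrightarrow> a i p = case_prod l i (t p)" for A :: "'a topology" and a t
        using spectral_map_mediating[OF that(2) _ _ that(4)] that(1,3) by simp
    qed
  }
qed

end
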